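(* Let $n\ge 3$, and let the dihedral group $D_{2n}$ of order $2n$ act on the free metabelian Lie algebra $L_2(\mathfrak A^2)$ over $\mathbb C$ with free generators $x,y$ and on $\mathbb C[u,v]$ as described in the context, where $u=x+iy$, $v=x-iy$. Let $L_2'(\mathfrak A^2)$ be the commutator ideal of $L_2(\mathfrak A^2)$. (i) The $\mathbb C[u,v]^{D_{2n}}$-module $L_2'(\mathfrak A^2)^{D_{2n}}$ is freely generated by the single element $$[v,u]\bigl(\mathrm{ad}^n(u)-\mathrm{ad}^n(v)\bigr).$$ (ii) The Hilbert series of $L_2(\mathfrak A^2)^{D_{2n}}$ is $$H(L_2(\mathfrak A^2)^{D_{2n}},t)=\frac{t^{n+2}}{(1-t^2)(1-t^n)}.$$
   Context: The ground field is $\mathbb C$. The metabelian variety of Lie algebras $\mathfrak A^2$ is defined by the identity $[[x_1,x_2],[x_3,x_4]]=0$. $L_2(\mathfrak A^2)$ is its relatively free Lie algebra of rank 2 with free generators $x,y$ (the quotient of the free Lie algebra on $x,y$ by its second derived ideal), graded by total degree in $x,y$; $L_2'(\mathfrak A^2)=[L_2(\mathfrak A^2),L_2(\mathfrak A^2)]$. Put $u=x+iy$, $v=x-iy$, which are also free generators. The operator $\mathrm{ad}(z)$ acts from the right: $w\,\mathrm{ad}(z)=[w,z]$. On $L_2'(\mathfrak A^2)$ the operators $\mathrm{ad}(u)$ and $\mathrm{ad}(v)$ commute, and $L_2'(\mathfrak A^2)$ is a module over the commutative polynomial algebra $\mathbb C[u,v]$ via $f(u,v):w\mapsto w\,f(\mathrm{ad}(u),\mathrm{ad}(v))$.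 The dihedral group $D_{2n}$ (symmetries of the regular $n$-gon, $n\ge 3$) is the group of linear automorphisms of $\mathbb Cx\oplus\mathbb Cy=\mathbb Cu\oplus\mathbb Cv$ generated by the rotation $\varrho:u\mapsto\xi u,\ v\mapsto\bar\xi v$, with $\xi=e^{2\pi i/n}$, and the reflection $\tau:u\leftrightarrow v$. It acts on $L_2(\mathfrak A^2)$ and on $\mathbb C[u,v]$ by algebra automorphisms extending this linear action: $g(f(u,v))=f(g(u),g(v))$. For each of these objects (and for $L_2'(\mathfrak A^2)$) the superscript $D_{2n}$ denotes the set of elements fixed by every $g\in D_{2n}$. The $\mathbb C[u,v]$-action restricts to a $\mathbb C[u,v]^{D_{2n}}$-module structure on $L_2'(\mathfrak A^2)^{D_{2n}}$. The Hilbert series of a graded vector space $W=\sum_{i\ge 0}W^{(i)}$ with finite dimensional components is $H(W,t)=\sum_{i\ge 0}\dim(W^{(i)})t^i$. *)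

theory Defs
  imports
    "HOL-Analysis.Analysis"
    "HOL-Computational_Algebra.Computational_Algebra"
    "HOL-Algebra.Generated_Groups"
    "Jordan_Normal_Form.Missing_VectorSpace"
begin

section \<open>Metabelian Lie algebras over the complex numbers\<close>

locale metabelian_lie_algebra =
  Vector_Spaces.vector_space scale
  for scale :: "complex \<Rightarrow> 'b::ab_group_add \<Rightarrow> 'b" +
  fixes brk :: "'b \<Rightarrow> 'b \<Rightarrow> 'b"
  assumes brk_add_left: "brk (a + b) c = brk a c + brk b c"
    and brk_add_right: "brk a (b + c) = brk a b + brk a c"
    and brk_scale_left: "brk (scale r a) b = scale r (brk a b)"
    and brk_scale_right: "brk a (scale r b) = scale r (brk a b)"
    and brk_alternating: "brk a a = 0"
    and brk_jacobi: "brk (brk a b) c + brk (brk b c) a + brk (brk c a) b = 0"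
    and brk_metabelian: "brk (brk a b) (brk c d) = 0"

section \<open>The free metabelian Lie algebra on x and y\<close>

text \<open>
  The relatively free algebra of the variety: formal Lie expressions in x and y modulo the
  least congruence containing all instances of the axioms of complex vector spaces, of Lie
  algebras, and of the metabelian identity.
\<close>

datatype lie_term =
    GenX | GenY
  | ZeroT
  | AddT lie_term lie_term
  | ScaleT complex lie_term
  | BrkT lie_term lie_term

inductive lie_eq :: "lie_term \<Rightarrow> lie_term \<Rightarrow> bool" where
  eq_refl: "lie_eq a a"
| eq_sym: "lie_eq a b \<Longrightarrow> lie_eq b a"
| eq_trans: "lie_eq a b \<Longrightarrow> lie_eq b c \<Longrightarrow> lie_eq a c"
| add_cong: "lie_eq a a' \<Longrightarrow> lie_eq b b' \<Longrightarrow> lie_eq (AddT a b) (AddT a' b')"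
| scale_cong: "lie_eq a a' \<Longrightarrow> lie_eq (ScaleT r a) (ScaleT r a')"
| brk_cong: "lie_eq a a' \<Longrightarrow> lie_eq b b' \<Longrightarrow> lie_eq (BrkT a b) (BrkT a' b')"
| add_assoc: "lie_eq (AddT (AddT a b) c) (AddT a (AddT b c))"
| add_comm: "lie_eq (AddT a b) (AddT b a)"
| add_zero: "lie_eq (AddT ZeroT a) a"
| add_neg: "lie_eq (AddT (ScaleT (- 1) a) a) ZeroT"
| scale_add_right: "lie_eq (ScaleT r (AddT a b)) (AddT (ScaleT r a) (ScaleT r b))"
| scale_add_left: "lie_eq (ScaleT (r + s) a) (AddT (ScaleT r a) (ScaleT s a))"
| scale_scale: "lie_eq (ScaleT r (ScaleT s a)) (ScaleT (r * s) a)"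
| scale_one: "lie_eq (ScaleT 1 a) a"
| brk_add_left: "lie_eq (BrkT (AddT a b) c) (AddT (BrkT a c) (BrkT b c))"
| brk_add_right: "lie_eq (BrkT a (AddT b c)) (AddT (BrkT a b) (BrkT a c))"
| brk_scale_left: "lie_eq (BrkT (ScaleT r a) b) (ScaleT r (BrkT a b))"
| brk_scale_right: "lie_eq (BrkT a (ScaleT r b)) (ScaleT r (BrkT a b))"
| alternating: "lie_eq (BrkT a a) ZeroT"
| jacobi: "lie_eq (AddT (AddT (BrkT (BrkT a b) c) (BrkT (BrkT b c) a)) (BrkT (BrkT c a) b)) ZeroT"
| metabelian: "lie_eq (BrkT (BrkT a b) (BrkT c d)) ZeroT"

quotient_type free_metab = lie_term / lie_eq
  by (rule equivpI) (auto intro: reflpI sympI transpI lie_eq.eq_refl lie_eq.eq_sym lie_eq.eq_trans)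

lift_definition genX :: free_metab is GenX .
lift_definition genY :: free_metab is GenY .
lift_definition scaleL :: "complex \<Rightarrow> free_metab \<Rightarrow> free_metab" is ScaleT
  by (rule lie_eq.scale_cong)
lift_definition brkL :: "free_metab \<Rightarrow> free_metab \<Rightarrow> free_metab" is BrkT
  by (rule lie_eq.brk_cong)

instantiation free_metab :: ab_group_add
begin

lift_definition zero_free_metab :: free_metab is ZeroT .
lift_definition plus_free_metab :: "free_metab \<Rightarrow> free_metab \<Rightarrow> free_metab" is AddT
  by (rule lie_eq.add_cong)
definition uminus_free_metab :: "free_metab \<Rightarrow> free_metab" where
  "- a = scaleL (- 1) a"
definition minus_free_metab :: "free_metab \<Rightarrow> free_metab \<Rightarrow> free_metab" where
  "(a :: free_metab) - b = a + - b"

instance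
proof
  fix a b c :: free_metab
  show "a + b + c = a + (b + c)" by transfer (rule lie_eq.add_assoc)
  show "a + b = b + a" by transfer (rule lie_eq.add_comm)
  show "0 + a = a" by transfer (rule lie_eq.add_zero)
  show "- a + a = 0" unfolding uminus_free_metab_def by transfer (rule lie_eq.add_neg)
  show "a - b = a + - b" by (rule minus_free_metab_def)
qed

end

global_interpretation L: metabelian_lie_algebra scaleL brkL
proof
  fix r s :: complex and a b c d :: free_metab
  show "scaleL r (a + b) = scaleL r a + scaleL r b" by transfer (rule lie_eq.scale_add_right)
  show "scaleL (r + s) a = scaleL r a + scaleL s a" by transfer (rule lie_eq.scale_add_left)
  show "scaleL r (scaleL s a) = scaleL (r * s) a" by transfer (rule lie_eq.scale_scale)
  show "scaleL 1 a = a" by transfer (rule lie_eq.scale_one)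
  show "brkL (a + b) c = brkL a c + brkL b c" by transfer (rule lie_eq.brk_add_left)
  show "brkL a (b + c) = brkL a b + brkL a c" by transfer (rule lie_eq.brk_add_right)
  show "brkL (scaleL r a) b = scaleL r (brkL a b)" by transfer (rule lie_eq.brk_scale_left)
  show "brkL a (scaleL r b) = scaleL r (brkL a b)" by transfer (rule lie_eq.brk_scale_right)
  show "brkL a a = 0" by transfer (rule lie_eq.alternating)
  show "brkL (brkL a b) c + brkL (brkL b c) a + brkL (brkL c a) b = 0"
    by transfer (rule lie_eq.jacobi)
  show "brkL (brkL a b) (brkL c d) = 0" by transfer (rule lie_eq.metabelian)
qed

subsection \<open>Universal property\<close>

primrec term_eval ::
  "(complex \<Rightarrow> 'b \<Rightarrow> 'b) \<Rightarrow> ('b \<Rightarrow> 'b \<Rightarrow> 'b) \<Rightarrow> 'b::ab_group_add \<Rightarrow> 'b \<Rightarrow> lie_term \<Rightarrow> 'b" where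
  "term_eval s br p q GenX = p"
| "term_eval s br p q GenY = q"
| "term_eval s br p q ZeroT = 0"
| "term_eval s br p q (AddT a b) = term_eval s br p q a + term_eval s br p q b"
| "term_eval s br p q (ScaleT r a) = s r (term_eval s br p q a)"
| "term_eval s br p q (BrkT a b) = br (term_eval s br p q a) (term_eval s br p q b)"

definition free_eval ::
  "(complex \<Rightarrow> 'b \<Rightarrow> 'b) \<Rightarrow> ('b \<Rightarrow> 'b \<Rightarrow> 'b) \<Rightarrow> 'b::ab_group_add \<Rightarrow> 'b \<Rightarrow> free_metab \<Rightarrow> 'b" where
  "free_eval s br p q w = term_eval s br p q (rep_free_metab w)"

definition lie_hom ::
  "(complex \<Rightarrow> 'b \<Rightarrow> 'b) \<Rightarrow> ('b \<Rightarrow> 'b \<Rightarrow> 'b) \<Rightarrow> (free_metab \<Rightarrow> 'b::ab_group_add) \<Rightarrow> bool" where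
  "lie_hom s br \<phi> \<longleftrightarrow>
     Vector_Spaces.linear scaleL s \<phi> \<and> (\<forall>a b. \<phi> (brkL a b) = br (\<phi> a) (\<phi> b))"

context metabelian_lie_algebra
begin

lemma term_eval_respects:
  "lie_eq a b \<Longrightarrow> term_eval scale brk p q a = term_eval scale brk p q b"
proof (induction rule: lie_eq.induct)
  case (jacobi a b c)
  show ?case by (simp add: brk_jacobi)
qed (simp_all add: brk_add_left brk_add_right brk_scale_left brk_scale_right
      brk_alternating brk_metabelian scale_left_distrib scale_right_distrib add.assoc add.commute)

lemma free_eval_abs: "free_eval scale brk p q (abs_free_metab t) = term_eval scale brk p q t"
  unfolding free_eval_def
  by (rule term_eval_respects) (simp add: Quotient3_free_metab rep_abs_rsp_left lie_eq.eq_refl)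

lemma free_eval_genX: "free_eval scale brk p q genX = p"
  by (simp add: genX.abs_eq free_eval_abs)

lemma free_eval_genY: "free_eval scale brk p q genY = q"
  by (simp add: genY.abs_eq free_eval_abs)

lemma free_eval_hom: "lie_hom scale brk (free_eval scale brk p q)"
proof -
  have 1: "free_eval scale brk p q (a + b) = free_eval scale brk p q a + free_eval scale brk p q b" for a b
    by (induction a; induction b) (simp add: plus_free_metab.abs_eq free_eval_abs)
  have 2: "free_eval scale brk p q (scaleL r a) = scale r (free_eval scale brk p q a)" for r a
    by (induction a) (simp add: scaleL.abs_eq free_eval_abs)
  have 3: "free_eval scale brk p q (brkL a b) = brk (free_eval scale brk p q a) (free_eval scale brk p q b)" for a b
    by (induction a; induction b) (simp add: brkL.abs_eq free_eval_abs)
  have "Vector_Spaces.linear scaleL scale (free_eval scale brk p q)"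
    by unfold_locales (simp_all add: 1 2)
  with 3 show ?thesis by (simp add: lie_hom_def)
qed

theorem universal_property:
  "\<exists>!\<phi>. lie_hom scale brk \<phi> \<and> \<phi> genX = p \<and> \<phi> genY = q"
proof (rule ex1I[of _ "free_eval scale brk p q"])
  fix \<phi> assume \<phi>: "lie_hom scale brk \<phi> \<and> \<phi> genX = p \<and> \<phi> genY = q"
  interpret \<phi>: Vector_Spaces.linear scaleL scale \<phi> using \<phi> by (simp add: lie_hom_def)
  have "\<phi> (abs_free_metab t) = term_eval scale brk p q t" for t
  proof (induction t)
    case (AddT a b)
    then show ?case by (simp add: \<phi>.add flip: plus_free_metab.abs_eq)
  next
    case (ScaleT r a)
    then show ?case by (simp add: \<phi>.scale flip: scaleL.abs_eq)
  next
    case (BrkT a b)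
    then show ?case using \<phi> by (simp add: lie_hom_def flip: brkL.abs_eq)
  qed (use \<phi> in \<open>simp_all add: \<phi>.zero flip: genX.abs_eq genY.abs_eq zero_free_metab.abs_eq\<close>)
  then have "\<phi> w = free_eval scale brk p q w" for w
    by (induction w) (simp add: free_eval_abs)
  then show "\<phi> = free_eval scale brk p q" ..
qed (simp add: free_eval_hom free_eval_genX free_eval_genY)

end

subsection \<open>Commutator ideal, grading, and the generators u and v\<close>

definition commutator_ideal :: "free_metab set" where
  "commutator_ideal = L.span {brkL a b | a b. True}"

inductive lie_monomial :: "free_metab \<Rightarrow> nat \<Rightarrow> bool" where
  "lie_monomial genX 1"
| "lie_monomial genY 1"
| "lie_monomial a i \<Longrightarrow> lie_monomial b j \<Longrightarrow> lie_monomial (brkL a b) (i + j)"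

definition homogeneous_component :: "nat \<Rightarrow> free_metab set" where
  "homogeneous_component i = L.span {m. lie_monomial m i}"

definition genU :: free_metab where "genU = genX + scaleL \<i> genY"
definition genV :: free_metab where "genV = genX - scaleL \<i> genY"

definition ad :: "free_metab \<Rightarrow> free_metab \<Rightarrow> free_metab" where
  "ad z = (\<lambda>w. brkL w z)"

lemma lie_monomial_pos: "lie_monomial m i \<Longrightarrow> i > 0"
  by (induction rule: lie_monomial.induct) auto

lemma finite_lie_monomials: "finite {m. lie_monomial m i}"
proof (induction i rule: less_induct)
  case (less i)
  have "{m. lie_monomial m i} \<subseteq> {genX, genY} \<union>
      (\<Union>j<i. \<Union>k<i. (\<lambda>(a, b). brkL a b) ` ({m. lie_monomial m j} \<times> {m. lie_monomial m k}))"
  proof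
    fix m assume "m \<in> {m. lie_monomial m i}"
    then have "lie_monomial m i" by simp
    then show "m \<in> {genX, genY} \<union>
      (\<Union>j<i. \<Union>k<i. (\<lambda>(a, b). brkL a b) ` ({m. lie_monomial m j} \<times> {m. lie_monomial m k}))"
    proof cases
      case (3 a j b k)
      then have "j < i" "k < i" using lie_monomial_pos by fastforce+
      with 3 show ?thesis by (intro UnI2 UN_I[of j] UN_I[of k]) auto
    qed auto
  qed
  then show ?case by (rule finite_subset) (use less in auto)
qed

lemma homogeneous_component_finite_dimensional:
  "\<exists>B. finite B \<and> homogeneous_component i = L.span B"
  unfolding homogeneous_component_def using finite_lie_monomials by blast

lemma homogeneous_components_span: "L.span (\<Union>i. homogeneous_component i) = UNIV"
proof -
  let ?S = "\<Union>i. {m. lie_monomial m i}"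
  have br: "brkL a b \<in> L.span ?S" if "a \<in> L.span ?S" "b \<in> L.span ?S" for a b
    using that(1)
  proof (induction rule: L.span_induct_alt)
    case base
    have "brkL 0 b = 0" using L.brk_scale_left[of 0 0 b] by simp
    then show ?case by (simp add: L.span_zero)
  next
    case (step c m y)
    have "brkL m b \<in> L.span ?S"
      using that(2)
    proof (induction rule: L.span_induct_alt)
      case base
      have "brkL m 0 = 0" using L.brk_scale_right[of m 0 0] by simp
      then show ?case by (simp add: L.span_zero)
    next
      case (step d k z)
      with \<open>m \<in> ?S\<close> have "brkL m k \<in> ?S" by (auto intro: lie_monomial.intros)
      with step show ?case
        by (simp add: L.brk_add_right L.brk_scale_right L.span_add L.span_scale L.span_base)
    qed
    with step show ?case
      by (simp add: L.brk_add_left L.brk_scale_left L.span_add L.span_scale)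
  qed
  have "abs_free_metab t \<in> L.span ?S" for t
  proof (induction t)
    case (BrkT a b)
    then show ?case using br by (simp flip: brkL.abs_eq)
  qed (auto simp: L.span_add L.span_scale L.span_zero
      simp flip: genX.abs_eq genY.abs_eq zero_free_metab.abs_eq plus_free_metab.abs_eq scaleL.abs_eq
      intro!: L.span_base lie_monomial.intros)
  then have "w \<in> L.span ?S" for w
    by (induction w) simp
  moreover have "L.span ?S \<subseteq> L.span (\<Union>i. homogeneous_component i)"
    unfolding homogeneous_component_def by (intro L.span_mono UN_mono) (auto intro: L.span_base)
  ultimately show ?thesis by blast
qed

lemma homogeneous_components_independent:
  assumes "\<And>i. i < N \<Longrightarrow> w i \<in> homogeneous_component i" and "(\<Sum>i<N. w i) = 0" and "i < N"
  shows "w i = 0"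
proof -
  let ?\<delta> = "free_eval scaleL brkL (scaleL 2 genX) (scaleL 2 genY)"
  interpret \<delta>: Vector_Spaces.linear scaleL scaleL ?\<delta>
    using L.free_eval_hom by (simp add: lie_hom_def)
  have br: "?\<delta> (brkL a b) = brkL (?\<delta> a) (?\<delta> b)" for a b
    using L.free_eval_hom by (simp add: lie_hom_def)
  have mono: "?\<delta> m = scaleL (2 ^ k) m" if "lie_monomial m k" for m k
    using that
    by induction (simp_all add: L.free_eval_genX L.free_eval_genY br L.brk_scale_left
        L.brk_scale_right power_add mult.commute)
  have eig: "?\<delta> a = scaleL (2 ^ k) a" if "a \<in> homogeneous_component k" for a k
    using that unfolding homogeneous_component_def
    by (induction rule: L.span_induct_alt)
      (simp_all add: mono \<delta>.add \<delta>.scale \<delta>.zero L.scale_right_distrib mult.commute)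
  show ?thesis
    using assms
  proof (induction N arbitrary: w i)
    case (Suc N)
    let ?w = "\<lambda>k. scaleL (2 ^ k - 2 ^ N) (w k)"
    have "(\<Sum>k<Suc N. ?w k) = ?\<delta> (\<Sum>k<Suc N. w k) - scaleL (2 ^ N) (\<Sum>k<Suc N. w k)"
      unfolding \<delta>.sum L.scale_sum_right sum_subtractf[symmetric]
      by (intro sum.cong) (auto simp: eig[OF Suc.prems(1)] L.scale_left_diff_distrib)
    also have "\<dots> = 0" by (simp only: Suc.prems(2) \<delta>.zero L.scale_zero_right diff_self)
    finally have sum0: "(\<Sum>k<N. ?w k) = 0" by simp
    have "w k = 0" if "k < N" for k
    proof -
      have "?w k = 0"
        by (rule Suc.IH[OF _ sum0 that])
          (use Suc.prems(1) in \<open>auto simp: homogeneous_component_def intro: L.span_scale\<close>)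
      moreover have "(2::complex) ^ k \<noteq> 2 ^ N"
      proof
        assume "(2::complex) ^ k = 2 ^ N"
        then have "of_nat (2 ^ k) = (of_nat (2 ^ N) :: complex)" by simp
        then have "(2::nat) ^ k = 2 ^ N" by (simp only: of_nat_eq_iff)
        with that show False by simp
      qed
      ultimately show ?thesis by simp
    qed
    with Suc.prems(2,3) show ?case
      by (cases "i = N") auto
  qed simp
qed

section \<open>The polynomial algebra in u, v and its action\<close>

text \<open>
  Polynomials in u and v are represented as polynomials in v whose coefficients are
  polynomials in u: the coefficient of u^i v^j in f is coeff (coeff f j) i.
\<close>

definition polyU :: "complex poly poly" where "polyU = [:[:0, 1:]:]"
definition polyV :: "complex poly poly" where "polyV = [:0, 1:]"

definition poly_subst :: "complex poly poly \<Rightarrow> complex poly poly \<Rightarrow> complex poly poly \<Rightarrow> complex poly poly" where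
  "poly_subst f p q =
     (\<Sum>j\<le>degree f. \<Sum>i\<le>degree (coeff f j). [:[:coeff (coeff f j) i:]:] * p ^ i * q ^ j)"

text \<open>
  As ad u and ad v commute only on the commutator ideal, this is meant only for arguments w
  in the commutator ideal.
\<close>

definition poly_act :: "complex poly poly \<Rightarrow> free_metab \<Rightarrow> free_metab" where
  "poly_act f w =
     (\<Sum>j\<le>degree f. \<Sum>i\<le>degree (coeff f j).
        scaleL (coeff (coeff f j) i) ((ad genV ^^ j) ((ad genU ^^ i) w)))"

section \<open>The dihedral group and its actions\<close>

text \<open>
  A vector p in complex^2 stands for the linear form p$1 u + p$2 v in the span of x and y.
\<close>

definition linear_auts :: "(complex^2 \<Rightarrow> complex^2) monoid" where
  "linear_auts =
     \<lparr>carrier = {g. Vector_Spaces.linear (*s) (*s) g \<and> bij g}, mult = (\<circ>), one = id\<rparr>"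

definition rotation :: "nat \<Rightarrow> complex^2 \<Rightarrow> complex^2" where
  "rotation n p =
     (let \<xi> = exp (2 * of_real pi * \<i> / of_nat n) in vector [\<xi> * p$1, cnj \<xi> * p$2])"

definition reflection :: "complex^2 \<Rightarrow> complex^2" where
  "reflection p = vector [p$2, p$1]"

definition dihedral :: "nat \<Rightarrow> (complex^2 \<Rightarrow> complex^2) set" where
  "dihedral n = generate linear_auts {rotation n, reflection}"

definition lin_lie :: "complex^2 \<Rightarrow> free_metab" where
  "lin_lie p = scaleL (p$1) genU + scaleL (p$2) genV"

definition lin_poly :: "complex^2 \<Rightarrow> complex poly poly" where
  "lin_poly p = [:[:p$1:]:] * polyU + [:[:p$2:]:] * polyV"

text \<open>
  The endomorphism extending g, given by its values at x = (u + v)/2 and y = (u - v)/(2i).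
\<close>

definition lie_action :: "(complex^2 \<Rightarrow> complex^2) \<Rightarrow> free_metab \<Rightarrow> free_metab" where
  "lie_action g = free_eval scaleL brkL
     (lin_lie (g (vector [1/2, 1/2]))) (lin_lie (g (vector [1/(2*\<i>), - 1/(2*\<i>)])))"

definition poly_action :: "(complex^2 \<Rightarrow> complex^2) \<Rightarrow> complex poly poly \<Rightarrow> complex poly poly" where
  "poly_action g f = poly_subst f (lin_poly (g (vector [1, 0]))) (lin_poly (g (vector [0, 1])))"

lemma linear_on_vec:
  fixes g :: "complex^2 \<Rightarrow> complex^2"
  assumes "\<And>p q. g (p + q) = g p + g q" "\<And>r p. g (r *s p) = r *s g p"
  shows "Vector_Spaces.linear (*s) (*s) g"
  by unfold_locales (simp_all add: assms)

lemma group_linear_auts: "Group.group linear_auts"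
proof (rule groupI)
  fix g assume "g \<in> carrier linear_auts"
  then have g: "Vector_Spaces.linear (*s) (*s) g" "bij g" by (auto simp: linear_auts_def)
  interpret g: Vector_Spaces.linear "(*s)" "(*s)" g by (rule g(1))
  have "Vector_Spaces.linear (*s) (*s) (inv_into UNIV g)"
  proof
    fix p q :: "complex^2" and r :: complex
    have gi: "g (inv_into UNIV g z) = z" for z using g(2) by (simp add: bij_is_surj surj_f_inv_f)
    have "inv_into UNIV g (g (inv_into UNIV g p + inv_into UNIV g q)) =
        inv_into UNIV g p + inv_into UNIV g q"
      "inv_into UNIV g (g (r *s inv_into UNIV g p)) = r *s inv_into UNIV g p"
      using g(2) by (simp_all add: bij_is_inj inv_f_f)
    then show "inv_into UNIV g (p + q) = inv_into UNIV g p + inv_into UNIV g q"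
      "inv_into UNIV g (r *s p) = r *s inv_into UNIV g p"
      by (simp_all add: g.add g.scale gi)
  qed
  with g show "\<exists>h\<in>carrier linear_auts. h \<otimes>\<^bsub>linear_auts\<^esub> g = \<one>\<^bsub>linear_auts\<^esub>"
    by (intro bexI[of _ "inv_into UNIV g"]) (auto simp: linear_auts_def bij_imp_bij_inv bij_is_inj)
qed (auto simp: linear_auts_def bij_comp Vector_Spaces.linear_compose vec.linear_id o_assoc)

lemma rotation_in_linear_auts: "rotation n \<in> carrier linear_auts"
proof -
  define \<xi> where "\<xi> = exp (2 * of_real pi * \<i> / of_nat n)"
  have "cnj \<xi> * \<xi> = 1"
    by (simp add: \<xi>_def exp_cnj flip: exp_add)
  then have inv: "cnj \<xi> * (\<xi> * z) = z" "\<xi> * (cnj \<xi> * z) = z" for z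
    by (simp_all flip: mult.assoc add: mult.commute)
  let ?h = "\<lambda>p::complex^2. vector [cnj \<xi> * p$1, \<xi> * p$2] :: complex^2"
  have "bij (rotation n)"
    by (rule o_bij[of ?h])
      (auto simp: fun_eq_iff rotation_def \<xi>_def[symmetric] Let_def vec_eq_iff forall_2 inv)
  then show ?thesis
    unfolding linear_auts_def
    by (auto intro!: linear_on_vec simp: rotation_def Let_def vec_eq_iff forall_2 algebra_simps)
qed

lemma reflection_in_linear_auts: "reflection \<in> carrier linear_auts"
proof -
  have "bij reflection"
    by (rule o_bij[of reflection]) (auto simp: fun_eq_iff reflection_def vec_eq_iff forall_2)
  then show ?thesis
    unfolding linear_auts_def
    by (auto intro!: linear_on_vec simp: reflection_def vec_eq_iff forall_2)
qed

lemma dihedral_linear: "g \<in> dihedral n \<Longrightarrow> Vector_Spaces.linear (*s) (*s) g"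
  using group.generate_incl[OF group_linear_auts, of "{rotation n, reflection}"]
    rotation_in_linear_auts reflection_in_linear_auts
  by (auto simp: dihedral_def linear_auts_def)

lemma lie_action_hom: "lie_hom scaleL brkL (lie_action g)"
  unfolding lie_action_def by (rule L.free_eval_hom)

lemma lie_action_extends:
  assumes "g \<in> dihedral n"
  shows "lie_action g (lin_lie p) = lin_lie (g p)"
proof -
  let ?e = "vector [1/2, 1/2] :: complex^2"
  let ?f = "vector [1/(2*\<i>), - 1/(2*\<i>)] :: complex^2"
  interpret act: Vector_Spaces.linear scaleL scaleL "lie_action g"
    using lie_action_hom by (simp add: lie_hom_def)
  interpret g: Vector_Spaces.linear "(*s)" "(*s)" g
    using assms by (rule dihedral_linear)
  have x: "lie_action g genX = lin_lie (g ?e)" and y: "lie_action g genY = lin_lie (g ?f)"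
    by (simp_all add: lie_action_def L.free_eval_genX L.free_eval_genY)
  have lin: "lin_lie (a *s q + b *s r) = scaleL a (lin_lie q) + scaleL b (lin_lie r)" for a b q r
    by (simp add: lin_lie_def L.scale_left_distrib L.scale_right_distrib ac_simps)
  have xy: "lin_lie p = scaleL (p$1 + p$2) genX + scaleL (\<i> * (p$1 - p$2)) genY"
    by (simp add: lin_lie_def genU_def genV_def L.scale_left_distrib L.scale_right_distrib
        L.scale_left_diff_distrib L.scale_right_diff_distrib algebra_simps)
  have p: "p = (p$1 + p$2) *s ?e + (\<i> * (p$1 - p$2)) *s ?f"
    by (simp add: vec_eq_iff forall_2 field_simps)
  have "lie_action g (lin_lie p) =
      scaleL (p$1 + p$2) (lin_lie (g ?e)) + scaleL (\<i> * (p$1 - p$2)) (lin_lie (g ?f))"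
    by (simp only: xy act.add act.scale x y)
  also have "\<dots> = lin_lie ((p$1 + p$2) *s g ?e + (\<i> * (p$1 - p$2)) *s g ?f)"
    by (rule lin[symmetric])
  also have "(p$1 + p$2) *s g ?e + (\<i> * (p$1 - p$2)) *s g ?f = g p"
    by (subst (5) p) (simp only: g.add g.scale)
  finally show ?thesis .
qed

definition lie_invariants :: "nat \<Rightarrow> free_metab set" where
  "lie_invariants n = {w. \<forall>g\<in>dihedral n. lie_action g w = w}"

definition poly_invariants :: "nat \<Rightarrow> complex poly poly set" where
  "poly_invariants n = {f. \<forall>g\<in>dihedral n. poly_action g f = f}"

section \<open>Invariants as a module, and Hilbert series\<close>

definition poly_invariant_ring :: "nat \<Rightarrow> complex poly poly ring" where
  "poly_invariant_ring n =
     \<lparr>carrier = poly_invariants n, mult = (*), one = 1, zero = 0, add = (+)\<rparr>"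

text \<open>The record fields mult and one play no role in a module.\<close>

definition commutator_invariant_module :: "nat \<Rightarrow> (complex poly poly, free_metab) module" where
  "commutator_invariant_module n =
     \<lparr>carrier = commutator_ideal \<inter> lie_invariants n, mult = undefined, one = undefined,
      zero = 0, add = (+), smult = poly_act\<rparr>"

definition freely_generated_by ::
  "('r, 'k) ring_scheme \<Rightarrow> ('r, 'm, 'l) module_scheme \<Rightarrow> 'm set \<Rightarrow> bool" where
  "freely_generated_by R M B \<longleftrightarrow>
     Module.module R M \<and> B \<subseteq> carrier M \<and>
     LinearCombinations.module.span R M B = carrier M \<and>
     \<not> LinearCombinations.module.lin_dep R M B"

definition hilbert_series :: "free_metab set \<Rightarrow> rat fps" where
  "hilbert_series W = Abs_fps (\<lambda>i. of_nat (L.dim (W \<inter> homogeneous_component i)))"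

end

theory Submission
  imports Defs
begin

text \<open>
  Write \<open>c\<close> for \<open>[v, u]\<close>. Every element of the free metabelian Lie algebra is
  uniquely \<open>l + c f(ad u, ad v)\<close> with \<open>l\<close> a linear form and \<open>f\<close> a polynomial, so the commutator
  ideal is the free cyclic \<open>\<complex>[u, v]\<close>-module on \<open>c\<close>. To see this, a Lie bracket is put on the space of
  pairs \<open>(l, f)\<close> by the formula that such a bracket has to satisfy. The universal property gives a
  homomorphism \<open>to_model\<close> to this concrete algebra; the obvious map \<open>of_model\<close> back is also a
  homomorphism. Going to the model and back fixes the generators and so is the identity, by
  universality; the other composition is computed directly
  (\<open>free_metab_normal_form\<close>, \<open>normal_form_unique\<close>).

  A linear substitution \<open>g\<close> multiplies \<open>c\<close> by its determinant and acts on the coefficient \<open>f\<close> by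
  substitution (\<open>lie_action_vu\<close>, \<open>lie_action_poly_act\<close>). The rotation has determinant 1 and fixes no
  nonzero linear form; the reflection has determinant -1. Hence all invariants lie in the
  commutator ideal, and they are the elements \<open>c f\<close> with \<open>f\<close> fixed by the rotation and negated by
  the reflection (\<open>lie_invariants_eq\<close>). Such a skew-invariant \<open>f\<close> is a combination of differences
  \<open>u^i v^j - u^j v^i\<close> with \<open>i\<close> and \<open>j\<close> congruent modulo \<open>n\<close>, and each of these is divisible by
  \<open>u^n - v^n\<close>; the quotient is invariant because \<open>u^n - v^n\<close> is itself skew-invariant and can be
  cancelled (\<open>skew_invariants_eq\<close>). This is the free generation.

  For the Hilbert series, the element \<open>c u^i v^j\<close> has degree \<open>i + j + 2\<close>, so the component of degree
  \<open>m + 2\<close> of the invariants has as a basis the differences above with \<open>i + j = m\<close> and \<open>j < i\<close>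
  (\<open>dim_homogeneous_invariants\<close>). With \<open>d = m - n\<close> these correspond to the ways to write \<open>d\<close> as a
  multiple of 2 plus a multiple of \<open>n\<close>, which is what the product of the geometric series
  \<open>1 / (1 - t^2)\<close> and \<open>1 / (1 - t^n)\<close> counts.
\<close>

section \<open>Polynomials in two variables\<close>

definition bicoeff :: "'a::zero poly poly \<Rightarrow> nat \<Rightarrow> nat \<Rightarrow> 'a" where
  "bicoeff f i j = coeff (coeff f j) i"

definition bimonom :: "'a::zero \<Rightarrow> nat \<Rightarrow> nat \<Rightarrow> 'a poly poly" where
  "bimonom a i j = monom (monom a i) j"

lemma bipoly_eqI: "(\<And>i j. bicoeff f i j = bicoeff g i j) \<Longrightarrow> f = g"
  by (simp add: bicoeff_def poly_eq_iff)

lemma bicoeff_0 [simp]: "bicoeff 0 i j = 0"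
  by (simp add: bicoeff_def)

lemma bicoeff_add [simp]: "bicoeff (f + g) i j = bicoeff f i j + bicoeff g i j"
  by (simp add: bicoeff_def)

lemma bicoeff_minus [simp]:
  fixes f :: "'a::ab_group_add poly poly"
  shows "bicoeff (- f) i j = - bicoeff f i j"
  by (simp add: bicoeff_def)

lemma bicoeff_diff [simp]:
  fixes f :: "'a::ab_group_add poly poly"
  shows "bicoeff (f - g) i j = bicoeff f i j - bicoeff g i j"
  by (simp add: bicoeff_def)

lemma bicoeff_sum [simp]: "bicoeff (\<Sum>x\<in>A. f x) i j = (\<Sum>x\<in>A. bicoeff (f x) i j)"
  by (simp add: bicoeff_def coeff_sum)

lemma bicoeff_const_mult [simp]:
  fixes f :: "'a::comm_semiring_1 poly poly"
  shows "bicoeff ([:[:a:]:] * f) i j = a * bicoeff f i j"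
  by (simp add: bicoeff_def)

lemma bicoeff_bimonom: "bicoeff (bimonom a k l) i j = (if k = i \<and> l = j then a else 0)"
  by (simp add: bicoeff_def bimonom_def)

lemma bimonom_0 [simp]: "bimonom 0 i j = 0"
  by (simp add: bimonom_def)

lemma bimonom_mult:
  fixes a b :: "'a::comm_semiring_0"
  shows "bimonom a i j * bimonom b k l = bimonom (a * b) (i + k) (j + l)"
  by (simp add: bimonom_def mult_monom)

lemma const_mult_bimonom:
  fixes a b :: "'a::comm_semiring_1"
  shows "[:[:a:]:] * bimonom b i j = bimonom (a * b) i j"
  by (simp add: bimonom_def smult_monom)

lemma const_eq_bimonom: "[:[:a:]:] = bimonom a 0 0"
  by (simp add: bimonom_def monom_0)

lemma one_eq_bimonom: "1 = bimonom 1 0 0"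
  by (simp add: bimonom_def)

lemma polyU_eq_bimonom: "polyU = bimonom 1 1 0"
  by (simp add: bimonom_def polyU_def monom_0 monom_altdef)

lemma polyV_eq_bimonom: "polyV = bimonom 1 0 1"
  by (simp add: bimonom_def polyV_def monom_altdef)

lemma bimonom_power: "bimonom a i j ^ k = bimonom (a ^ k) (k * i) (k * j)"
  for a :: "'a::comm_semiring_1"
  by (induction k) (simp_all add: bimonom_mult one_eq_bimonom)

lemma polyU_power: "polyU ^ k = bimonom 1 k 0"
  by (simp add: polyU_eq_bimonom bimonom_power)

lemma polyV_power: "polyV ^ k = bimonom 1 0 k"
  by (simp add: polyV_eq_bimonom bimonom_power)

lemma bipoly_as_sum:
  "f = (\<Sum>j\<le>degree f. \<Sum>i\<le>degree (coeff f j). bimonom (bicoeff f i j) i j)"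
proof -
  have "f = (\<Sum>j\<le>degree f. monom (coeff f j) j)"
    by (simp add: poly_as_sum_of_monoms)
  also have "\<dots> = (\<Sum>j\<le>degree f. monom (\<Sum>i\<le>degree (coeff f j). monom (bicoeff f i j) i) j)"
    by (simp add: bicoeff_def poly_as_sum_of_monoms)
  finally show ?thesis
    by (simp add: bimonom_def monom_sum)
qed

lemma bipoly_induct [case_names add monom]:
  assumes "\<And>f g. P f \<Longrightarrow> P g \<Longrightarrow> P (f + g)" and "\<And>a i j. P (bimonom a i j)"
  shows "P f"
proof -
  have zero: "P 0"
    using assms(2)[of 0 0 0] by simp
  have sum: "finite A \<Longrightarrow> (\<And>x. x \<in> A \<Longrightarrow> P (h x)) \<Longrightarrow> P (\<Sum>x\<in>A. h x)"
    for A :: "nat set" and h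
    by (induction A rule: finite_induct) (auto intro: zero assms(1))
  show ?thesis
    by (subst bipoly_as_sum) (intro sum assms(2) finite_atMost)
qed

lemma finite_bicoeff_support: "finite {(i, j). bicoeff f i j \<noteq> 0}"
proof (rule finite_subset)
  show "{(i, j). bicoeff f i j \<noteq> 0} \<subseteq>
      (\<Union>j\<in>{..degree f}. \<Union>i\<in>{..degree (coeff f j)}. {(i, j)})"
    by (force simp: bicoeff_def intro: le_degree)
qed auto

text \<open>
  The sums that define substitution and the action of polynomials run over index ranges that depend
  on the degrees of the polynomial. Replacing the range by any finite set that contains the support
  makes the sums of different polynomials comparable, which is what additivity needs.
\<close>

lemma bicoeff_sum_eq_sum_support:
  fixes F :: "'a::zero \<Rightarrow> nat \<Rightarrow> nat \<Rightarrow> 'b::comm_monoid_add"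
  assumes F0: "\<And>i j. F 0 i j = 0"
    and S: "finite S" "{(i, j). bicoeff f i j \<noteq> 0} \<subseteq> S"
  shows "(\<Sum>j\<le>degree f. \<Sum>i\<le>degree (coeff f j). F (bicoeff f i j) i j) =
    (\<Sum>(i, j)\<in>S. F (bicoeff f i j) i j)"
proof -
  let ?T = "SIGMA j:{..degree f}. {..degree (coeff f j)}"
  have inT: "(j, i) \<in> ?T" if "bicoeff f i j \<noteq> 0" for i j
    using that by (force simp: bicoeff_def intro: le_degree)
  have "(\<Sum>j\<le>degree f. \<Sum>i\<le>degree (coeff f j). F (bicoeff f i j) i j) =
      (\<Sum>(j, i)\<in>?T. F (bicoeff f i j) i j)"
    by (rule sum.Sigma) auto
  also have "\<dots> = (\<Sum>(i, j)\<in>prod.swap ` ?T. F (bicoeff f i j) i j)"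
    by (subst sum.reindex) (auto simp: case_prod_unfold)
  also have "\<dots> = (\<Sum>(i, j)\<in>{(i, j). bicoeff f i j \<noteq> 0}. F (bicoeff f i j) i j)"
    by (rule sum.mono_neutral_right) (use inT F0 in \<open>force+\<close>)
  also have "\<dots> = (\<Sum>(i, j)\<in>S. F (bicoeff f i j) i j)"
    by (rule sum.mono_neutral_left) (use S F0 in auto)
  finally show ?thesis .
qed

lemma bicoeff_sum_add:
  fixes F :: "'a::comm_monoid_add \<Rightarrow> nat \<Rightarrow> nat \<Rightarrow> 'b::comm_monoid_add"
  assumes F0: "\<And>i j. F 0 i j = 0" and F: "\<And>a b i j. F (a + b) i j = F a i j + F b i j"
  shows "(\<Sum>j\<le>degree (f + g). \<Sum>i\<le>degree (coeff (f + g) j). F (bicoeff (f + g) i j) i j) =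
    (\<Sum>j\<le>degree f. \<Sum>i\<le>degree (coeff f j). F (bicoeff f i j) i j) +
    (\<Sum>j\<le>degree g. \<Sum>i\<le>degree (coeff g j). F (bicoeff g i j) i j)"
proof -
  define S where "S = {(i, j). bicoeff f i j \<noteq> 0} \<union> {(i, j). bicoeff g i j \<noteq> 0}"
  have S: "finite S"
    unfolding S_def by (intro finite_UnI finite_bicoeff_support)
  have "{(i, j). bicoeff f i j \<noteq> 0} \<subseteq> S" "{(i, j). bicoeff g i j \<noteq> 0} \<subseteq> S"
    "{(i, j). bicoeff (f + g) i j \<noteq> 0} \<subseteq> S"
    by (auto simp: S_def)
  note this [THEN bicoeff_sum_eq_sum_support [of F, OF F0 S]]
  then show ?thesis
    by (simp add: F sum.distrib case_prod_unfold)
qed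

lemma bicoeff_sum_bimonom:
  fixes F :: "'a::zero \<Rightarrow> nat \<Rightarrow> nat \<Rightarrow> 'b::comm_monoid_add"
  assumes F0: "\<And>i j. F 0 i j = 0"
  shows "(\<Sum>j\<le>degree (bimonom a k l). \<Sum>i\<le>degree (coeff (bimonom a k l) j).
    F (bicoeff (bimonom a k l) i j) i j) = F a k l"
proof -
  have "{(i, j). bicoeff (bimonom a k l) i j \<noteq> 0} \<subseteq> {(k, l)}"
    by (auto simp: bicoeff_bimonom split: if_splits)
  note bicoeff_sum_eq_sum_support [of F, OF F0 _ this]
  then show ?thesis
    by (simp add: bicoeff_bimonom)
qed

subsection \<open>Substitution\<close>

lemma poly_subst_bicoeff: "poly_subst f p q =
    (\<Sum>j\<le>degree f. \<Sum>i\<le>degree (coeff f j). [:[:bicoeff f i j:]:] * p ^ i * q ^ j)"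
  by (simp add: poly_subst_def bicoeff_def)

lemma poly_subst_add: "poly_subst (f + g) p q = poly_subst f p q + poly_subst g p q"
proof -
  have "[:[:a + b:]:] = [:[:a:]:] + [:[:b:]:]" for a b :: complex by simp
  then show ?thesis
    unfolding poly_subst_bicoeff
    by (intro bicoeff_sum_add [where F = "\<lambda>a i j. [:[:a:]:] * p ^ i * q ^ j"])
      (simp_all only: distrib_right, simp)
qed

lemma poly_subst_bimonom: "poly_subst (bimonom a i j) p q = [:[:a:]:] * p ^ i * q ^ j"
  unfolding poly_subst_bicoeff
  by (rule bicoeff_sum_bimonom [where F = "\<lambda>a i j. [:[:a:]:] * p ^ i * q ^ j"]) simp

lemma poly_subst_mult: "poly_subst (f * g) p q = poly_subst f p q * poly_subst g p q"
proof (induction f rule: bipoly_induct)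
  case (monom a i j)
  show ?case
  proof (induction g rule: bipoly_induct)
    case (monom b k l)
    have "[:[:a * b:]:] = [:[:a:]:] * [:[:b:]:]" by simp
    then show ?case
      by (simp only: bimonom_mult poly_subst_bimonom power_add ac_simps)
  qed (simp add: poly_subst_add distrib_left)
qed (simp add: poly_subst_add distrib_right)

lemma poly_subst_const [simp]: "poly_subst [:[:a:]:] p q = [:[:a:]:]"
  using poly_subst_bimonom[of a 0 0] by (simp add: const_eq_bimonom)

lemma poly_subst_1 [simp]: "poly_subst 1 p q = 1"
  using poly_subst_const[of 1 p q] by (simp add: pCons_one)

lemma poly_subst_polyU [simp]: "poly_subst polyU p q = p"
  by (simp add: polyU_eq_bimonom poly_subst_bimonom pCons_one)

lemma poly_subst_polyV [simp]: "poly_subst polyV p q = q"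
  by (simp add: polyV_eq_bimonom poly_subst_bimonom pCons_one)

lemma poly_subst_power: "poly_subst (f ^ k) p q = poly_subst f p q ^ k"
  by (induction k) (simp_all add: poly_subst_mult)

section \<open>The commutator ideal as a module over the polynomials\<close>

lemma brkL_commute: "brkL a b = - brkL b a"
proof -
  have "brkL (a + b) (a + b) = (brkL a a + brkL a b) + (brkL b a + brkL b b)"
    by (simp only: L.brk_add_left L.brk_add_right ac_simps)
  then have "brkL a b + brkL b a = 0"
    by (simp add: L.brk_alternating)
  then show ?thesis
    by (simp only: eq_neg_iff_add_eq_0)
qed

lemma brkL_0_left [simp]: "brkL 0 a = 0"
  using L.brk_scale_left[of 0 0 a] by simp

lemma brkL_0_right [simp]: "brkL a 0 = 0"
  using L.brk_scale_right[of a 0 0] by simp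

lemma brkL_minus_left: "brkL (- a) b = - brkL a b"
  using L.brk_add_left[of "- a" a b] by (simp add: eq_neg_iff_add_eq_0)

lemma brkL_in_commutator_ideal: "brkL a b \<in> commutator_ideal"
  unfolding commutator_ideal_def by (rule L.span_base) auto

lemma subspace_commutator_ideal: "L.subspace commutator_ideal"
  unfolding commutator_ideal_def by (rule L.subspace_span)

lemma commutator_ideal_abelian:
  assumes "w \<in> commutator_ideal" "z \<in> commutator_ideal"
  shows "brkL w z = 0"
proof -
  have *: "brkL w (brkL a b) = 0" for a b
    using assms(1) unfolding commutator_ideal_def
    by (induction rule: L.span_induct_alt)
      (auto simp: L.brk_add_left L.brk_scale_left L.brk_metabelian)
  show ?thesis
    using assms(2) unfolding commutator_ideal_def
    by (induction rule: L.span_induct_alt)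
      (auto simp: L.brk_add_right L.brk_scale_right *)
qed

text \<open>
  By the Jacobi identity the two sides differ by a bracket of \<open>w\<close> with a commutator, which
  vanishes because the commutator ideal is abelian.
\<close>

lemma ad_commute:
  assumes "w \<in> commutator_ideal"
  shows "ad a (ad b w) = ad b (ad a w)"
proof -
  have "brkL (brkL w b) a + brkL (brkL b a) w + brkL (brkL a w) b = 0"
    by (rule L.brk_jacobi)
  moreover have "brkL (brkL b a) w = 0"
    using brkL_in_commutator_ideal assms by (rule commutator_ideal_abelian)
  moreover have "brkL (brkL a w) b = - brkL (brkL w a) b"
    by (simp only: brkL_commute[of a w] brkL_minus_left)
  ultimately show ?thesis
    by (simp add: ad_def)
qed

lemma ad_closed: "ad a w \<in> commutator_ideal"
  by (simp add: ad_def brkL_in_commutator_ideal)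

lemma ad_power_closed: "w \<in> commutator_ideal \<Longrightarrow> (ad a ^^ k) w \<in> commutator_ideal"
  by (cases k) (simp_all add: ad_closed)

lemma ad_add: "ad a (w + z) = ad a w + ad a z"
  by (simp add: ad_def L.brk_add_left)

lemma ad_scale: "ad a (scaleL r w) = scaleL r (ad a w)"
  by (simp add: ad_def L.brk_scale_left)

lemma ad_power_add: "(ad a ^^ k) (w + z) = (ad a ^^ k) w + (ad a ^^ k) z"
  by (induction k) (simp_all add: ad_add)

lemma ad_power_scale: "(ad a ^^ k) (scaleL r w) = scaleL r ((ad a ^^ k) w)"
  by (induction k) (simp_all add: ad_scale)

lemma ad_power_commute:
  assumes "w \<in> commutator_ideal"
  shows "(ad a ^^ k) ((ad b ^^ l) w) = (ad b ^^ l) ((ad a ^^ k) w)"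
proof -
  have *: "ad b ((ad a ^^ k) z) = (ad a ^^ k) (ad b z)" if "z \<in> commutator_ideal" for z
    using that by (induction k) (simp_all add: ad_commute[of _ b a] ad_power_closed)
  show ?thesis
    using assms by (induction l) (simp_all add: ad_power_closed flip: *)
qed

lemma poly_act_bicoeff: "poly_act f w =
    (\<Sum>j\<le>degree f. \<Sum>i\<le>degree (coeff f j).
      scaleL (bicoeff f i j) ((ad genV ^^ j) ((ad genU ^^ i) w)))"
  by (simp add: poly_act_def bicoeff_def)

lemma poly_act_add_left: "poly_act (f + g) w = poly_act f w + poly_act g w"
  unfolding poly_act_bicoeff
  by (rule bicoeff_sum_add [where F = "\<lambda>a i j. scaleL a ((ad genV ^^ j) ((ad genU ^^ i) w))"])
    (simp_all add: L.scale_left_distrib)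

lemma poly_act_bimonom:
  "poly_act (bimonom a i j) w = scaleL a ((ad genV ^^ j) ((ad genU ^^ i) w))"
  unfolding poly_act_bicoeff
  by (rule bicoeff_sum_bimonom [where F = "\<lambda>a i j. scaleL a ((ad genV ^^ j) ((ad genU ^^ i) w))"])
    simp

lemma poly_act_0_left [simp]: "poly_act 0 w = 0"
  using poly_act_add_left[of 0 0 w] by simp

lemma poly_act_minus_left: "poly_act (- f) w = - poly_act f w"
  using poly_act_add_left[of "- f" f w] by (simp add: eq_neg_iff_add_eq_0)

lemma poly_act_diff_left: "poly_act (f - g) w = poly_act f w - poly_act g w"
  using poly_act_add_left[of f "- g" w] by (simp add: poly_act_minus_left)

lemma poly_act_sum_left: "poly_act (\<Sum>x\<in>A. f x) w = (\<Sum>x\<in>A. poly_act (f x) w)"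
  by (induction A rule: infinite_finite_induct) (simp_all add: poly_act_add_left)

lemma poly_act_add_right: "poly_act f (w + z) = poly_act f w + poly_act f z"
  by (induction f rule: bipoly_induct)
    (simp_all add: poly_act_add_left poly_act_bimonom ad_power_add L.scale_right_distrib)

lemma poly_act_scale_right: "poly_act f (scaleL r w) = scaleL r (poly_act f w)"
  by (induction f rule: bipoly_induct)
    (simp_all add: poly_act_add_left poly_act_bimonom ad_power_scale L.scale_right_distrib
      mult.commute)

lemma poly_act_1 [simp]: "poly_act 1 w = w"
  by (simp add: one_eq_bimonom poly_act_bimonom)

lemma poly_act_const [simp]: "poly_act [:[:a:]:] w = scaleL a w"
  by (simp add: const_eq_bimonom poly_act_bimonom)

lemma poly_act_closed: "w \<in> commutator_ideal \<Longrightarrow> poly_act f w \<in> commutator_ideal"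
  by (induction f rule: bipoly_induct)
    (simp_all add: poly_act_add_left poly_act_bimonom ad_power_closed
      L.subspace_add[OF subspace_commutator_ideal] L.subspace_scale[OF subspace_commutator_ideal])

text \<open>
  The module law for the action: on monomials it amounts to commuting powers of \<open>ad u\<close> and
  \<open>ad v\<close>, which is possible on the commutator ideal only.
\<close>

lemma poly_act_mult:
  assumes "w \<in> commutator_ideal"
  shows "poly_act (f * g) w = poly_act f (poly_act g w)"
proof (induction f rule: bipoly_induct)
  case (monom a i j)
  show ?case
  proof (induction g rule: bipoly_induct)
    case (monom b k l)
    have "(ad genU ^^ i) ((ad genV ^^ l) ((ad genU ^^ k) w)) =
        (ad genV ^^ l) ((ad genU ^^ i) ((ad genU ^^ k) w))"
      by (rule ad_power_commute) (simp add: ad_power_closed assms)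
    then show ?case
      by (simp add: bimonom_mult poly_act_bimonom funpow_add ad_power_scale)
  qed (simp add: poly_act_add_left poly_act_add_right distrib_left)
qed (simp add: poly_act_add_left distrib_right)

lemma poly_act_polyU [simp]: "poly_act polyU w = ad genU w"
  by (simp add: polyU_eq_bimonom poly_act_bimonom)

lemma poly_act_polyV [simp]: "poly_act polyV w = ad genV w"
  by (simp add: polyV_eq_bimonom poly_act_bimonom)

lemma poly_act_const_mult: "poly_act ([:[:a:]:] * f) w = scaleL a (poly_act f w)"
  by (induction f rule: bipoly_induct)
    (simp_all only: distrib_left poly_act_add_left const_mult_bimonom poly_act_bimonom
      L.scale_right_distrib L.scale_scale)

lemma poly_act_lin_poly: "poly_act (lin_poly p) w = ad (lin_lie p) w"
  by (simp only: lin_poly_def lin_lie_def poly_act_add_left poly_act_const_mult poly_act_polyU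
      poly_act_polyV) (simp add: ad_def L.brk_add_right L.brk_scale_right)

lemma poly_act_lin_poly_power:
  "w \<in> commutator_ideal \<Longrightarrow> poly_act (lin_poly p ^ k) w = (ad (lin_lie p) ^^ k) w"
  by (induction k) (simp_all add: poly_act_mult poly_act_lin_poly)

section \<open>A model of the free metabelian Lie algebra\<close>

lemma lin_lie_lincomb: "lin_lie (a *s p + b *s q) = scaleL a (lin_lie p) + scaleL b (lin_lie q)"
  by (simp add: lin_lie_def L.scale_left_distrib L.scale_right_distrib ac_simps)

lemma lin_lie_add: "lin_lie (p + q) = lin_lie p + lin_lie q"
  using lin_lie_lincomb[of 1 p 1 q] by simp

lemma lin_lie_scale: "lin_lie (r *s p) = scaleL r (lin_lie p)"
  using lin_lie_lincomb[of r p 0 0] by simp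

lemma const_add: "[:[:a + b:]:] = [:[:a:]:] + ([:[:b:]:] :: complex poly poly)"
  by simp

lemma const_diff: "[:[:a - b:]:] = [:[:a:]:] - ([:[:b:]:] :: complex poly poly)"
  by simp

lemma const_mult: "[:[:a * b:]:] = [:[:a:]:] * ([:[:b:]:] :: complex poly poly)"
  by simp

lemma const_1: "[:[:1:]:] = (1 :: complex poly poly)"
  by (simp add: pCons_one)

lemma lin_poly_add: "lin_poly (p + q) = lin_poly p + lin_poly q"
  by (simp only: lin_poly_def vector_add_component const_add algebra_simps)

lemma lin_poly_scale: "lin_poly (r *s p) = [:[:r:]:] * lin_poly p"
  by (simp add: lin_poly_def algebra_simps)

lemma genX_eq_lin_lie: "genX = lin_lie (vector [1/2, 1/2])"
  and genY_eq_lin_lie: "genY = lin_lie (vector [1/(2*\<i>), - 1/(2*\<i>)])"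
proof -
  show "genX = lin_lie (vector [1/2, 1/2])"
    by (simp add: lin_lie_def genU_def genV_def L.scale_right_distrib L.scale_right_diff_distrib
        flip: L.scale_left_distrib)
  have "lin_lie (vector [1/(2*\<i>), - 1/(2*\<i>)]) = scaleL (1/(2*\<i>)) (genU - genV)"
    by (simp add: lin_lie_def L.scale_right_diff_distrib)
  also have "genU - genV = scaleL (2 * \<i>) genY"
    by (simp add: genU_def genV_def flip: L.scale_left_distrib)
  finally show "genY = lin_lie (vector [1/(2*\<i>), - 1/(2*\<i>)])"
    by simp
qed

lemma genU_eq_lin_lie: "genU = lin_lie (vector [1, 0])"
  and genV_eq_lin_lie: "genV = lin_lie (vector [0, 1])"
  by (simp_all add: lin_lie_def)

lemma polyU_eq_lin_poly: "polyU = lin_poly (vector [1, 0])"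
  and polyV_eq_lin_poly: "polyV = lin_poly (vector [0, 1])"
  by (simp_all add: lin_poly_def pCons_one)

lemma brkL_lin_lie:
  "brkL (lin_lie p) (lin_lie q) = scaleL (p$2 * q$1 - p$1 * q$2) (brkL genV genU)"
proof -
  have "brkL genU genV = - brkL genV genU"
    by (rule brkL_commute)
  then show ?thesis
    by (simp add: lin_lie_def L.brk_add_left L.brk_add_right L.brk_scale_left L.brk_scale_right
        L.brk_alternating L.scale_left_diff_distrib mult.commute)
qed

text \<open>
  The pair \<open>(p, f)\<close> stands for the sum of the linear form with coordinates \<open>p\<close> and the element
  \<open>[v, u] f(ad u, ad v)\<close>. The bracket below is forced: two linear forms have a multiple of
  \<open>[v, u]\<close> as bracket, the factor being a determinant, a linear form acts on the second component by
  multiplication, and the bracket of two second components vanishes.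
\<close>

type_synonym model = "(complex^2) \<times> complex poly poly"

definition model_scale :: "complex \<Rightarrow> model \<Rightarrow> model" where
  "model_scale r A = (r *s fst A, [:[:r:]:] * snd A)"

definition model_brk :: "model \<Rightarrow> model \<Rightarrow> model" where
  "model_brk A B = (0, [:[:fst A$2 * fst B$1 - fst A$1 * fst B$2:]:]
     + snd A * lin_poly (fst B) - snd B * lin_poly (fst A))"

text \<open>
  In the Jacobi identity, the terms with determinants cancel because three vectors \<open>p\<close>, \<open>q\<close>, \<open>r\<close> of
  a plane satisfy \<open>det(p, q) r + det(q, r) p + det(r, p) q = 0\<close>; the other terms cancel because
  polynomials commute.
\<close>

global_interpretation Model: metabelian_lie_algebra model_scale model_brk
proof
  fix r s :: complex and A B C D :: model
  show "model_scale r (A + B) = model_scale r A + model_scale r B"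
    by (simp add: model_scale_def vec.scale_right_distrib distrib_left smult_add_right)
  show "model_scale (r + s) A = model_scale r A + model_scale s A"
    unfolding model_scale_def const_add by (simp only: vec.scale_left_distrib distrib_right add_Pair)
  show "model_scale r (model_scale s A) = model_scale (r * s) A"
    by (simp add: model_scale_def)
  show "model_scale 1 A = A"
    by (simp only: model_scale_def const_1) simp
  show "model_brk (A + B) C = model_brk A C + model_brk B C"
    "model_brk A (B + C) = model_brk A B + model_brk A C"
    unfolding model_brk_def add_Pair
    by (simp_all only: const_add const_diff const_mult lin_poly_add fst_add snd_add
      vector_add_component distrib_right distrib_left) (simp_all only: prod.inject add_0_right algebra_simps simp_thms)
  show "model_brk (model_scale r A) B = model_scale r (model_brk A B)"
    "model_brk A (model_scale r B) = model_scale r (model_brk A B)"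
    unfolding model_brk_def model_scale_def fst_conv snd_conv
    by (simp_all only: const_diff const_mult lin_poly_scale vector_smult_component prod.inject
      vec.scale_zero_right algebra_simps simp_thms)
  show "model_brk A A = 0"
    by (simp add: model_brk_def zero_prod_def mult.commute)
  show "model_brk (model_brk A B) C + model_brk (model_brk B C) A + model_brk (model_brk C A) B = 0"
    unfolding model_brk_def add_Pair fst_conv snd_conv zero_prod_def lin_poly_def
    by (simp only: const_diff const_mult zero_index prod.inject add_0_right pCons_0_0 mult_zero_left mult_zero_right
        diff_self diff_0_right add_0_left algebra_simps simp_thms)
  show "model_brk (model_brk A B) (model_brk C D) = 0"
    by (simp add: model_brk_def zero_prod_def lin_poly_def)
qed

text \<open>
  The two vectors on the right are the coordinates of \<open>x\<close> and \<open>y\<close> with respect to \<open>u\<close> and \<open>v\<close>, so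
  this decomposition reduces statements on linear forms to the free generators.
\<close>

lemma vec_2_decomposition:
  "p = (p$1 + p$2) *s vector [1/2, 1/2] + (\<i> * (p$1 - p$2)) *s vector [1/(2*\<i>), - 1/(2*\<i>)]"
  for p :: "complex^2"
  by (simp add: vec_eq_iff forall_2 field_simps)

lemma vec_2_basis: "p = p$1 *s vector [1, 0] + p$2 *s vector [0, 1]"
  for p :: "complex^2"
  by (simp add: vec_eq_iff forall_2)

lemma lin_lie_genXY: "lin_lie p = scaleL (p$1 + p$2) genX + scaleL (\<i> * (p$1 - p$2)) genY"
  by (subst vec_2_decomposition) (simp only: lin_lie_lincomb genX_eq_lin_lie genY_eq_lin_lie)

abbreviation vu :: free_metab where
  "vu \<equiv> brkL genV genU"

lemma vu_in_commutator_ideal [simp]: "vu \<in> commutator_ideal"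
  by (rule brkL_in_commutator_ideal)

definition of_model :: "model \<Rightarrow> free_metab" where
  "of_model A = lin_lie (fst A) + poly_act (snd A) vu"

definition to_model :: "free_metab \<Rightarrow> model" where
  "to_model = free_eval model_scale model_brk
     (vector [1/2, 1/2], 0) (vector [1/(2*\<i>), - 1/(2*\<i>)], 0)"

lemma of_model_add: "of_model (A + B) = of_model A + of_model B"
  by (simp add: of_model_def lin_lie_add poly_act_add_left)

lemma of_model_scale: "of_model (model_scale r A) = scaleL r (of_model A)"
  by (simp only: of_model_def model_scale_def fst_conv snd_conv lin_lie_scale poly_act_const_mult
      L.scale_right_distrib)

lemma of_model_brk: "of_model (model_brk A B) = brkL (of_model A) (of_model B)"
proof -
  let ?p = "fst A" and ?q = "fst B" and ?f = "snd A" and ?g = "snd B"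
  have "brkL (of_model A) (of_model B) =
      brkL (lin_lie ?p) (lin_lie ?q) + brkL (lin_lie ?p) (poly_act ?g vu) +
      brkL (poly_act ?f vu) (lin_lie ?q) + brkL (poly_act ?f vu) (poly_act ?g vu)"
    by (simp add: of_model_def L.brk_add_left L.brk_add_right)
  also have "brkL (poly_act ?f vu) (poly_act ?g vu) = 0"
    by (simp add: commutator_ideal_abelian poly_act_closed)
  also have "brkL (poly_act ?f vu) (lin_lie ?q) = poly_act (?f * lin_poly ?q) vu"
    by (simp add: mult.commute[of ?f] poly_act_mult poly_act_lin_poly ad_def)
  also have "brkL (lin_lie ?p) (poly_act ?g vu) = - poly_act (?g * lin_poly ?p) vu"
    by (subst brkL_commute)
      (simp add: mult.commute[of ?g] poly_act_mult poly_act_lin_poly ad_def)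
  also have "brkL (lin_lie ?p) (lin_lie ?q) = poly_act [:[:?p$2 * ?q$1 - ?p$1 * ?q$2:]:] vu"
    by (simp only: brkL_lin_lie poly_act_const)
  finally show ?thesis
    by (simp only: of_model_def model_brk_def fst_conv snd_conv poly_act_add_left
        poly_act_diff_left) (simp add: lin_lie_def)
qed

lemma to_model_hom: "lie_hom model_scale model_brk to_model"
  unfolding to_model_def by (rule Model.free_eval_hom)

interpretation to_model: Vector_Spaces.linear scaleL model_scale to_model
  using to_model_hom by (simp add: lie_hom_def)

lemma to_model_brk: "to_model (brkL a b) = model_brk (to_model a) (to_model b)"
  using to_model_hom by (simp add: lie_hom_def)

lemma to_model_lin_lie: "to_model (lin_lie p) = (p, 0)"
proof -
  have "to_model genX = (vector [1/2, 1/2], 0)"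
    "to_model genY = (vector [1/(2*\<i>), - 1/(2*\<i>)], 0)"
    unfolding to_model_def by (rule Model.free_eval_genX Model.free_eval_genY)+
  then have "to_model (lin_lie p) =
      ((p$1 + p$2) *s vector [1/2, 1/2] + (\<i> * (p$1 - p$2)) *s vector [1/(2*\<i>), - 1/(2*\<i>)], 0)"
    by (simp only: lin_lie_genXY to_model.add to_model.scale model_scale_def fst_conv snd_conv
        add_Pair mult_zero_right add_0_right)
  then show ?thesis
    by (simp only: vec_2_decomposition[symmetric])
qed

lemma to_model_ad_power:
  assumes "to_model w = (0, f)"
  shows "to_model ((ad (lin_lie p) ^^ k) w) = (0, f * lin_poly p ^ k)"
  using assms
  by (induction k)
    (simp_all add: ad_def to_model_brk to_model_lin_lie model_brk_def mult_ac)

lemma to_model_poly_act: "to_model (poly_act f vu) = (0, f)"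
proof (induction f rule: bipoly_induct)
  case (monom a i j)
  have "to_model vu = (0, 1)"
    unfolding genU_eq_lin_lie genV_eq_lin_lie
    by (simp add: to_model_brk to_model_lin_lie model_brk_def const_1)
  then have "to_model ((ad genV ^^ j) ((ad genU ^^ i) vu)) = (0, polyU ^ i * polyV ^ j)"
    unfolding genU_eq_lin_lie genV_eq_lin_lie polyU_eq_lin_poly polyV_eq_lin_poly
    by (metis to_model_ad_power mult_1_left)
  then show ?case
    by (simp only: poly_act_bimonom to_model.scale model_scale_def fst_conv snd_conv
        polyU_power polyV_power bimonom_mult const_mult_bimonom vec.scale_zero_right) simp
qed (simp add: poly_act_add_left to_model.add)

lemma to_model_of_model: "to_model (of_model A) = A"
  by (simp add: of_model_def to_model.add to_model_lin_lie to_model_poly_act)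

text \<open>
  Going to the model and back is an endomorphism that fixes the free generators, so it is the
  identity by the universal property.
\<close>

lemma of_model_to_model: "of_model (to_model w) = w"
proof -
  have hom: "lie_hom scaleL brkL (\<lambda>w. of_model (to_model w))"
    unfolding lie_hom_def
    by (intro conjI allI, unfold_locales)
      (simp_all add: to_model.add to_model.scale to_model_brk of_model_add of_model_scale of_model_brk)
  have hom_id: "lie_hom scaleL brkL (\<lambda>w. w)"
    unfolding lie_hom_def by (intro conjI allI refl, unfold_locales) simp_all
  have lin: "of_model (to_model (lin_lie p)) = lin_lie p" for p
    by (simp add: of_model_def to_model_lin_lie)
  have "(\<lambda>w. of_model (to_model w)) = (\<lambda>w. w)"
    using L.universal_property[of genX genY] hom hom_id lin[folded genX_eq_lin_lie]
      lin genX_eq_lin_lie genY_eq_lin_lie by metis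
  then show ?thesis
    by (rule fun_cong)
qed

lemma free_metab_normal_form:
  obtains p f where "w = lin_lie p + poly_act f vu"
  using of_model_to_model[of w] by (metis of_model_def)

lemma normal_form_unique:
  assumes "lin_lie p + poly_act f vu = lin_lie q + poly_act g vu"
  shows "p = q" "f = g"
proof -
  have "of_model (p, f) = of_model (q, g)"
    using assms by (simp add: of_model_def)
  then have "(p, f) = (q, g)"
    by (metis to_model_of_model)
  then show "p = q" "f = g"
    by simp_all
qed

lemma poly_act_vu_eq_iff: "poly_act f vu = poly_act g vu \<longleftrightarrow> f = g"
  using normal_form_unique(2)[of 0 f 0 g] by auto

section \<open>Linear substitutions\<close>

lemma lie_action_brk: "lie_action g (brkL a b) = brkL (lie_action g a) (lie_action g b)"
  using lie_action_hom by (simp add: lie_hom_def)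

interpretation lie_action: Vector_Spaces.linear scaleL scaleL "lie_action g"
  using lie_action_hom by (simp add: lie_hom_def)

lemma lie_action_lin_lie:
  assumes "Vector_Spaces.linear (*s) (*s) g"
  shows "lie_action g (lin_lie p) = lin_lie (g p)"
proof -
  interpret g: Vector_Spaces.linear "(*s)" "(*s)" g
    by (rule assms)
  let ?e = "vector [1/2, 1/2] :: complex^2"
  let ?f = "vector [1/(2*\<i>), - 1/(2*\<i>)] :: complex^2"
  have "lie_action g genX = lin_lie (g ?e)" "lie_action g genY = lin_lie (g ?f)"
    by (simp_all add: lie_action_def L.free_eval_genX L.free_eval_genY)
  then have "lie_action g (lin_lie p) =
      lin_lie (g ((p$1 + p$2) *s ?e + (\<i> * (p$1 - p$2)) *s ?f))"
    by (simp only: lin_lie_genXY[of p] lie_action.add lie_action.scale g.add g.scale lin_lie_lincomb)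
  then show ?thesis
    by (simp only: vec_2_decomposition[symmetric])
qed

lemma lie_action_closed:
  assumes "w \<in> commutator_ideal"
  shows "lie_action g w \<in> commutator_ideal"
  using assms[unfolded commutator_ideal_def]
  by (induction rule: L.span_induct_alt)
    (auto simp: lie_action.zero lie_action.add lie_action.scale lie_action_brk
      brkL_in_commutator_ideal L.subspace_0[OF subspace_commutator_ideal]
      L.subspace_add[OF subspace_commutator_ideal] L.subspace_scale[OF subspace_commutator_ideal])

lemma lie_action_comp:
  assumes "Vector_Spaces.linear (*s) (*s) g" "Vector_Spaces.linear (*s) (*s) h"
  shows "lie_action (g \<circ> h) w = lie_action g (lie_action h w)"
proof -
  have gh: "Vector_Spaces.linear (*s) (*s) (g \<circ> h)"
    using assms(2,1) by (rule Vector_Spaces.linear_compose)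
  have "lie_hom scaleL brkL (\<lambda>w. lie_action g (lie_action h w))"
    unfolding lie_hom_def
    by (intro conjI allI, unfold_locales)
      (simp_all add: lie_action.add lie_action.scale lie_action_brk)
  moreover have "lie_action g (lie_action h (lin_lie p)) = lie_action (g \<circ> h) (lin_lie p)" for p
    by (simp add: lie_action_lin_lie assms gh)
  ultimately have "(\<lambda>w. lie_action g (lie_action h w)) = lie_action (g \<circ> h)"
    using L.universal_property[of "lie_action (g \<circ> h) genX" "lie_action (g \<circ> h) genY"]
      lie_action_hom[of "g \<circ> h"] genX_eq_lin_lie genY_eq_lin_lie by metis
  then show ?thesis
    by metis
qed

lemma lie_action_id: "lie_action id w = w"
proof -
  have "lie_hom scaleL brkL (\<lambda>w. w)"
    unfolding lie_hom_def by (intro conjI allI refl, unfold_locales) simp_all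
  moreover have "lie_action id (lin_lie p) = lin_lie p" for p
    by (simp add: lie_action_lin_lie vec.linear_id)
  ultimately have "lie_action id = (\<lambda>w. w)"
    using L.universal_property[of genX genY]
      lie_action_hom[of "id"] genX_eq_lin_lie genY_eq_lin_lie by metis
  then show ?thesis
    by metis
qed

lemma poly_action_add: "poly_action g (f + h) = poly_action g f + poly_action g h"
  by (simp add: poly_action_def poly_subst_add)

lemma poly_action_mult: "poly_action g (f * h) = poly_action g f * poly_action g h"
  by (simp add: poly_action_def poly_subst_mult)

lemma poly_action_const: "poly_action g [:[:a:]:] = [:[:a:]:]"
  by (simp add: poly_action_def)

lemma poly_action_1: "poly_action g 1 = 1"
  by (simp add: poly_action_def)

lemma poly_action_0: "poly_action g 0 = 0"
  using poly_action_add[of g 0 0] by simp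

lemma poly_action_minus: "poly_action g (- f) = - poly_action g f"
  using poly_action_add[of g "- f" f] by (simp add: poly_action_0 eq_neg_iff_add_eq_0)

lemma poly_action_bimonom: "poly_action g (bimonom a i j) =
    [:[:a:]:] * lin_poly (g (vector [1, 0])) ^ i * lin_poly (g (vector [0, 1])) ^ j"
  by (simp only: poly_action_def poly_subst_bimonom)

lemma poly_action_lin_poly:
  assumes "Vector_Spaces.linear (*s) (*s) g"
  shows "poly_action g (lin_poly p) = lin_poly (g p)"
proof -
  interpret g: Vector_Spaces.linear "(*s)" "(*s)" g
    by (rule assms)
  have "poly_action g (lin_poly p) = lin_poly (g (p$1 *s vector [1, 0] + p$2 *s vector [0, 1]))"
    by (simp only: lin_poly_def[of p] poly_action_def poly_subst_add poly_subst_mult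
        poly_subst_const poly_subst_polyU poly_subst_polyV g.add g.scale lin_poly_add lin_poly_scale)
  then show ?thesis
    by (simp only: vec_2_basis[symmetric])
qed

lemma poly_action_comp:
  assumes "Vector_Spaces.linear (*s) (*s) g" "Vector_Spaces.linear (*s) (*s) h"
  shows "poly_action (g \<circ> h) f = poly_action g (poly_action h f)"
proof (induction f rule: bipoly_induct)
  case (monom a i j)
  have "poly_action g (p ^ k) = poly_action g p ^ k" for p k
    by (simp add: poly_action_def poly_subst_power)
  then show ?case
    by (simp only: poly_action_bimonom poly_action_mult poly_action_const
        poly_action_lin_poly[OF assms(1)] comp_apply)
qed (simp add: poly_action_add)

lemma poly_action_id: "poly_action id f = f"
proof (induction f rule: bipoly_induct)
  case (monom a i j)
  show ?case
    by (simp only: poly_action_bimonom id_apply polyU_eq_lin_poly[symmetric]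
        polyV_eq_lin_poly[symmetric] polyU_power polyV_power const_mult_bimonom bimonom_mult) simp
qed (simp add: poly_action_add)

text \<open>
  The two actions of \<open>g\<close> are compatible with the module structure: \<open>g\<close> turns \<open>ad z\<close> into
  \<open>ad (g z)\<close>, and \<open>ad\<close> of a linear form is the action of the corresponding linear polynomial.
\<close>

lemma lie_action_poly_act:
  assumes g: "Vector_Spaces.linear (*s) (*s) g" and w: "w \<in> commutator_ideal"
  shows "lie_action g (poly_act f w) = poly_act (poly_action g f) (lie_action g w)"
proof (induction f rule: bipoly_induct)
  case (monom a i j)
  have ad: "lie_action g ((ad (lin_lie p) ^^ k) z) = (ad (lin_lie (g p)) ^^ k) (lie_action g z)" for p k z
    by (induction k) (simp_all add: ad_def lie_action_brk lie_action_lin_lie g)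
  have gw: "lie_action g w \<in> commutator_ideal"
    by (rule lie_action_closed[OF w])
  have "poly_act (poly_action g (bimonom a i j)) (lie_action g w) =
      poly_act ([:[:a:]:] * (lin_poly (g (vector [0, 1])) ^ j * lin_poly (g (vector [1, 0])) ^ i))
        (lie_action g w)"
    by (simp only: poly_action_bimonom ac_simps)
  also have "\<dots> = scaleL a ((ad (lin_lie (g (vector [0, 1]))) ^^ j)
      ((ad (lin_lie (g (vector [1, 0]))) ^^ i) (lie_action g w)))"
    by (simp only: poly_act_const_mult poly_act_const poly_act_mult[OF gw] poly_act_lin_poly_power
        ad_power_closed gw)
  finally show ?case
    by (simp only: poly_act_bimonom lie_action.scale ad genU_eq_lin_lie genV_eq_lin_lie)
qed (simp add: poly_act_add_left poly_action_add lie_action.add)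

text \<open>
  The factor is the determinant of \<open>g\<close> in the basis \<open>u\<close>, \<open>v\<close>.
\<close>

lemma lie_action_vu:
  assumes "Vector_Spaces.linear (*s) (*s) g"
  shows "lie_action g vu = scaleL
    (g (vector [1, 0]) $ 1 * g (vector [0, 1]) $ 2 - g (vector [0, 1]) $ 1 * g (vector [1, 0]) $ 2) vu"
  by (simp only: genU_eq_lin_lie genV_eq_lin_lie lie_action_brk lie_action_lin_lie[OF assms])
    (simp add: brkL_lin_lie mult.commute flip: genU_eq_lin_lie genV_eq_lin_lie)

section \<open>Dihedral invariants\<close>

text \<open>
  It suffices to test invariance on the two generators of the group. Both actions are covered by
  letting \<open>act\<close> be any map that is compatible with composition at \<open>w\<close>.
\<close>

lemma dihedral_fixed_iff:
  fixes act :: "(complex^2 \<Rightarrow> complex^2) \<Rightarrow> 'a \<Rightarrow> 'a"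
  assumes comp: "\<And>g h. Vector_Spaces.linear (*s) (*s) g \<Longrightarrow> Vector_Spaces.linear (*s) (*s) h \<Longrightarrow>
      act (g \<circ> h) w = act g (act h w)"
    and id: "act id w = w"
  shows "(\<forall>g\<in>dihedral n. act g w = w) \<longleftrightarrow> act (rotation n) w = w \<and> act reflection w = w"
proof (intro iffI conjI ballI)
  interpret G: Group.group linear_auts
    by (rule group_linear_auts)
  have lin: "Vector_Spaces.linear (*s) (*s) g" if "g \<in> carrier linear_auts" for g
    using that by (simp add: linear_auts_def)
  have gens: "{rotation n, reflection} \<subseteq> carrier linear_auts"
    using rotation_in_linear_auts reflection_in_linear_auts by blast
  fix g
  assume fixed: "act (rotation n) w = w \<and> act reflection w = w" and "g \<in> dihedral n"
  then have "g \<in> generate linear_auts {rotation n, reflection}"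
    by (simp add: dihedral_def)
  then show "act g w = w"
  proof induction
    case one
    then show ?case
      using id by (simp add: linear_auts_def id_def)
  next
    case (incl h)
    then show ?case
      using fixed by blast
  next
    case (inv h)
    then have h: "h \<in> carrier linear_auts" "act h w = w"
      using gens fixed by blast+
    have "act (inv\<^bsub>linear_auts\<^esub> h \<circ> h) w = act (inv\<^bsub>linear_auts\<^esub> h) (act h w)"
      using h(1) by (intro comp lin G.inv_closed)
    moreover have "inv\<^bsub>linear_auts\<^esub> h \<circ> h = id"
      using G.l_inv[OF h(1)] by (simp add: linear_auts_def)
    ultimately show ?case
      using h(2) id by simp
  next
    case (eng h1 h2)
    then have "h1 \<in> carrier linear_auts" "h2 \<in> carrier linear_auts"
      using G.generate_incl[OF gens] by blast+
    then have "act (h1 \<circ> h2) w = act h1 (act h2 w)"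
      by (intro comp lin)
    then show ?case
      using eng.IH by (simp add: linear_auts_def comp_def)
  qed
qed (auto simp: dihedral_def intro: generate.incl)

lemma linear_rotation: "Vector_Spaces.linear (*s) (*s) (rotation n)"
  using rotation_in_linear_auts by (simp add: linear_auts_def)

lemma linear_reflection: "Vector_Spaces.linear (*s) (*s) reflection"
  using reflection_in_linear_auts by (simp add: linear_auts_def)

lemma lie_invariants_iff_generators:
  "w \<in> lie_invariants n \<longleftrightarrow> lie_action (rotation n) w = w \<and> lie_action reflection w = w"
  using dihedral_fixed_iff[of lie_action w n] by (simp add: lie_invariants_def lie_action_comp lie_action_id)

lemma poly_invariants_iff_generators:
  "f \<in> poly_invariants n \<longleftrightarrow> poly_action (rotation n) f = f \<and> poly_action reflection f = f"
  using dihedral_fixed_iff[of poly_action f n]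
  by (simp add: poly_invariants_def poly_action_comp poly_action_id)

lemma lin_poly_scaled_basis:
  "lin_poly (vector [a, 0]) = bimonom a 1 0" "lin_poly (vector [0, a]) = bimonom a 0 1"
  by (simp_all only: lin_poly_def vector_2 pCons_0_0 mult_zero_left add_0_left add_0_right
      polyU_eq_bimonom polyV_eq_bimonom const_mult_bimonom mult_1_right)

lemma bicoeff_poly_action_diagonal:
  assumes "g (vector [1, 0]) = vector [a, 0]" "g (vector [0, 1]) = vector [0, b]"
  shows "bicoeff (poly_action g f) i j = a ^ i * b ^ j * bicoeff f i j"
proof (induction f rule: bipoly_induct)
  case (monom c k l)
  have "poly_action g (bimonom c k l) = bimonom (c * a ^ k * b ^ l) k l"
    by (simp only: poly_action_bimonom assms lin_poly_scaled_basis bimonom_power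
        const_mult_bimonom bimonom_mult) simp
  then show ?case
    by (simp add: bicoeff_bimonom)
qed (simp add: poly_action_add distrib_left)

definition root_of_unity :: "nat \<Rightarrow> complex" where
  "root_of_unity n = exp (2 * of_real pi * \<i> / of_nat n)"

lemma root_of_unity_cnj: "root_of_unity n * cnj (root_of_unity n) = 1"
  by (simp add: root_of_unity_def exp_cnj flip: exp_add)

lemma root_of_unity_power: "root_of_unity n ^ i = exp (2 * of_real pi * \<i> * of_nat i / of_nat n)"
  unfolding root_of_unity_def by (subst exp_of_nat_mult[symmetric]) (simp add: mult_ac)

text \<open>
  The product of powers on the left is the factor by which the rotation multiplies the monomial \<open>u^i v^j\<close>.
\<close>

lemma root_of_unity_power_cnj_eq_1_iff:
  assumes "n > 0"
  shows "root_of_unity n ^ i * cnj (root_of_unity n) ^ j = 1 \<longleftrightarrow> i mod n = j mod n"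
proof -
  let ?x = "root_of_unity n"
  have x: "?x ^ j * cnj ?x ^ j = 1"
    by (simp add: root_of_unity_cnj flip: power_mult_distrib)
  have "?x ^ i * cnj ?x ^ j = 1 \<longleftrightarrow> ?x ^ i * cnj ?x ^ j = ?x ^ j * cnj ?x ^ j"
    by (simp add: x)
  also have "\<dots> \<longleftrightarrow> ?x ^ i = ?x ^ j"
    using x by (metis mult_cancel_right mult_zero_right zero_neq_one)
  also have "\<dots> \<longleftrightarrow> i mod n = j mod n"
    unfolding root_of_unity_power using assms by (intro complex_root_unity_eq) simp
  finally show ?thesis .
qed

lemma rotation_eq: "rotation n p = vector [root_of_unity n * p$1, cnj (root_of_unity n) * p$2]"
  by (simp add: rotation_def Let_def root_of_unity_def)

lemma rotation_fixes_poly_iff: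
  assumes "n > 0"
  shows "poly_action (rotation n) f = f \<longleftrightarrow> (\<forall>i j. bicoeff f i j \<noteq> 0 \<longrightarrow> i mod n = j mod n)"
proof -
  have "bicoeff (poly_action (rotation n) f) i j =
      root_of_unity n ^ i * cnj (root_of_unity n) ^ j * bicoeff f i j" for i j
    by (rule bicoeff_poly_action_diagonal) (simp_all add: rotation_eq)
  then have "poly_action (rotation n) f = f \<longleftrightarrow>
      (\<forall>i j. root_of_unity n ^ i * cnj (root_of_unity n) ^ j * bicoeff f i j = bicoeff f i j)"
    by (metis bipoly_eqI)
  then show ?thesis
    by (simp add: root_of_unity_power_cnj_eq_1_iff[OF assms, symmetric])
      blast
qed

lemma reflection_bimonom: "poly_action reflection (bimonom a i j) = bimonom a j i"
  by (simp only: poly_action_bimonom reflection_def vector_2 lin_poly_scaled_basis bimonom_power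
      const_mult_bimonom bimonom_mult) simp

lemma bicoeff_reflection: "bicoeff (poly_action reflection f) i j = bicoeff f j i"
  by (induction f rule: bipoly_induct)
    (auto simp: poly_action_add reflection_bimonom bicoeff_bimonom)

lemma rotation_vu: "lie_action (rotation n) vu = vu"
  by (simp add: lie_action_vu[OF linear_rotation] rotation_eq root_of_unity_cnj)

lemma reflection_vu: "lie_action reflection vu = - vu"
  by (simp add: lie_action_vu[OF linear_reflection] reflection_def)

text \<open>
  The semi-invariants for the determinant character, which is trivial on the rotation and -1 on the
  reflection.
\<close>

definition skew_invariants :: "nat \<Rightarrow> complex poly poly set" where
  "skew_invariants n = {f. poly_action (rotation n) f = f \<and> poly_action reflection f = - f}"

lemma poly_act_vu_invariant_iff: "poly_act f vu \<in> lie_invariants n \<longleftrightarrow> f \<in> skew_invariants n"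
proof -
  have "lie_action (rotation n) (poly_act f vu) = poly_act (poly_action (rotation n) f) vu"
    by (simp add: lie_action_poly_act linear_rotation rotation_vu)
  moreover have "lie_action reflection (poly_act f vu) = poly_act (- poly_action reflection f) vu"
    using poly_act_scale_right[of "poly_action reflection f" "- 1" vu]
    by (simp add: lie_action_poly_act linear_reflection reflection_vu poly_act_minus_left)
  moreover have "- poly_action reflection f = f \<longleftrightarrow> poly_action reflection f = - f"
    by (rule minus_equation_iff[THEN trans]) (rule eq_commute)
  ultimately show ?thesis
    by (simp add: lie_invariants_iff_generators skew_invariants_def poly_act_vu_eq_iff)
qed

text \<open>
  An invariant has no linear part: the rotation multiplies \<open>u\<close> and \<open>v\<close> by \<open>\<xi>\<close> and its conjugate, and
  neither of them is 1 once \<open>n \<ge> 2\<close>. The sign by which the reflection acts on \<open>[v, u]\<close> makes the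
  polynomial coefficient skew.
\<close>

lemma lie_invariants_eq:
  assumes "n \<ge> 2"
  shows "lie_invariants n = (\<lambda>f. poly_act f vu) ` skew_invariants n"
proof
  show "(\<lambda>f. poly_act f vu) ` skew_invariants n \<subseteq> lie_invariants n"
    by (auto simp: poly_act_vu_invariant_iff)
  show "lie_invariants n \<subseteq> (\<lambda>f. poly_act f vu) ` skew_invariants n"
  proof
    fix w assume w: "w \<in> lie_invariants n"
    obtain p f where pf: "w = lin_lie p + poly_act f vu"
      by (rule free_metab_normal_form)
    have "lie_action (rotation n) w =
        lin_lie (rotation n p) + poly_act (poly_action (rotation n) f) vu"
      by (simp add: pf lie_action.add lie_action_lin_lie lie_action_poly_act linear_rotation
          rotation_vu)
    then have "lin_lie (rotation n p) + poly_act (poly_action (rotation n) f) vu =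
        lin_lie p + poly_act f vu"
      using w by (simp add: lie_invariants_iff_generators pf)
    then have "rotation n p = p"
      by (rule normal_form_unique)
    then have "root_of_unity n * p$1 = p$1" "cnj (root_of_unity n) * p$2 = p$2"
      by (simp_all add: rotation_eq vec_eq_iff forall_2)
    moreover have "root_of_unity n \<noteq> 1" "cnj (root_of_unity n) \<noteq> 1"
      using assms root_of_unity_power_cnj_eq_1_iff[of n 1 0]
        root_of_unity_power_cnj_eq_1_iff[of n 0 1] by auto
    ultimately have "p = 0"
      by (simp add: vec_eq_iff forall_2)
    then have "w = poly_act f vu"
      by (simp add: pf lin_lie_def)
    then show "w \<in> (\<lambda>f. poly_act f vu) ` skew_invariants n"
      using w by (auto simp: poly_act_vu_invariant_iff)
  qed
qed

section \<open>Skew-invariant polynomials\<close>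

lemma diff_dvd_power_diff: "x - y dvd x ^ k - y ^ k"
  for x y :: "'a::comm_ring_1"
  by (cases k) (simp_all add: diff_power_eq_sum del: power_Suc)

text \<open>
  For \<open>i = j + n k\<close> the difference is \<open>a (u v)^j ((u^n)^k - (v^n)^k)\<close>; exchanging \<open>i\<close> and \<open>j\<close> changes
  its sign only.
\<close>

lemma power_diff_dvd_bimonom_diff:
  assumes "i mod n = j mod n"
  shows "polyU ^ n - polyV ^ n dvd bimonom a i j - bimonom a j i"
proof -
  have le: "polyU ^ n - polyV ^ n dvd bimonom a i j - bimonom a j i"
    if "j \<le> i" "i mod n = j mod n" for i j
  proof -
    have "n dvd i - j"
      using that by (simp add: mod_eq_dvd_iff_nat)
    then obtain k where "i - j = n * k"
      by (rule dvdE)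
    then have "i = j + n * k"
      using that(1) by simp
    then have "bimonom a i j - bimonom a j i =
        bimonom a j j * ((polyU ^ n) ^ k - (polyV ^ n) ^ k)"
      by (simp add: right_diff_distrib polyU_power polyV_power bimonom_mult
          bimonom_power mult.commute)
    then show ?thesis
      by (simp add: diff_dvd_power_diff)
  qed
  show ?thesis
  proof (cases "j \<le> i")
    case False
    then have "polyU ^ n - polyV ^ n dvd - (bimonom a j i - bimonom a i j)"
      unfolding dvd_minus_iff using assms by (intro le) auto
    then show ?thesis
      by simp
  qed (use le assms in blast)
qed

text \<open>
  A skew-invariant \<open>f\<close> equals half the difference of \<open>f\<close> and its reflection. Monomial by
  monomial, this writes it as a combination of differences \<open>u^i v^j - u^j v^i\<close>, and invariance under
  the rotation leaves only congruent exponents.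
\<close>

lemma power_diff_dvd_skew_invariant:
  assumes n: "n > 0" and f: "f \<in> skew_invariants n"
  shows "polyU ^ n - polyV ^ n dvd f"
proof -
  have sum: "poly_action reflection (\<Sum>x\<in>A. h x) = (\<Sum>x\<in>A. poly_action reflection (h x))"
    for A :: "nat set" and h
    by (induction A rule: infinite_finite_induct) (simp_all add: poly_action_0 poly_action_add)
  have "f + f = f - poly_action reflection f"
    using f by (simp add: skew_invariants_def)
  also have "\<dots> = (\<Sum>j\<le>degree f. \<Sum>i\<le>degree (coeff f j).
      bimonom (bicoeff f i j) i j - bimonom (bicoeff f i j) j i)"
    by (subst (1 2) bipoly_as_sum) (simp add: sum reflection_bimonom sum_subtractf)
  finally have ff: "f + f = \<dots>" .
  have "polyU ^ n - polyV ^ n dvd bimonom (bicoeff f i j) i j - bimonom (bicoeff f i j) j i" for i j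
  proof (cases "bicoeff f i j = 0")
    case False
    then show ?thesis
      using f n by (intro power_diff_dvd_bimonom_diff) (simp add: skew_invariants_def rotation_fixes_poly_iff)
  qed simp
  then have "polyU ^ n - polyV ^ n dvd f + f"
    unfolding ff by (intro dvd_sum)
  then have "polyU ^ n - polyV ^ n dvd [:[:1/2:]:] * (f + f)"
    by (rule dvd_mult)
  also have "[:[:1/2:]:] * (f + f) = f"
    by (intro bipoly_eqI) (simp only: bicoeff_const_mult bicoeff_add, simp)
  finally show ?thesis .
qed

lemma power_diff_skew_invariant: "n > 0 \<Longrightarrow> polyU ^ n - polyV ^ n \<in> skew_invariants n"
  by (auto simp: skew_invariants_def rotation_fixes_poly_iff polyU_power polyV_power bicoeff_bimonom
      bicoeff_reflection intro!: bipoly_eqI split: if_splits)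

lemma power_diff_nonzero:
  assumes "n > 0" 
  shows "polyU ^ n - polyV ^ n \<noteq> 0"
proof
  assume "polyU ^ n - polyV ^ n = 0"
  then have "bicoeff (polyU ^ n - polyV ^ n) n 0 = 0"
    by simp
  then show False
    using assms by (simp add: polyU_power polyV_power bicoeff_bimonom)
qed

text \<open>
  The quotient of a skew-invariant by \<open>u^n - v^n\<close> is invariant, since applying a group element to the
  product changes the product and the factor \<open>u^n - v^n\<close> by the same sign, and \<open>u^n - v^n\<close> can be
  cancelled from the resulting equation.
\<close>

lemma skew_invariants_eq:
  assumes n: "n > 0"
  shows "skew_invariants n = (\<lambda>g. g * (polyU ^ n - polyV ^ n)) ` poly_invariants n"
proof
  let ?d = "polyU ^ n - polyV ^ n"
  have d: "poly_action (rotation n) ?d = ?d" "poly_action reflection ?d = - ?d"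
    using power_diff_skew_invariant[OF n] by (simp_all add: skew_invariants_def)
  have d0: "?d \<noteq> 0"
    by (rule power_diff_nonzero[OF n])
  show "(\<lambda>g. g * ?d) ` poly_invariants n \<subseteq> skew_invariants n"
    unfolding skew_invariants_def using d
    by (auto simp: poly_invariants_iff_generators poly_action_mult simp del: minus_diff_eq)
  show "skew_invariants n \<subseteq> (\<lambda>g. g * ?d) ` poly_invariants n"
  proof
    fix f assume f: "f \<in> skew_invariants n"
    then obtain g where g: "f = ?d * g"
      using power_diff_dvd_skew_invariant[OF n] by blast
    have "?d * poly_action (rotation n) g = ?d * g" "- ?d * poly_action reflection g = - (?d * g)"
      using f[unfolded skew_invariants_def g] by (simp_all only: mem_Collect_eq poly_action_mult d)
    then have "g \<in> poly_invariants n"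
      using d0 by (simp add: poly_invariants_iff_generators del: minus_diff_eq)
    then show "f \<in> (\<lambda>g. g * ?d) ` poly_invariants n"
      unfolding g mult.commute[of ?d g] by (rule imageI)
  qed
qed

section \<open>Free generation\<close>

lemma poly_invariants_closed:
  "1 \<in> poly_invariants n" "0 \<in> poly_invariants n"
  "f \<in> poly_invariants n \<Longrightarrow> - f \<in> poly_invariants n"
  "f \<in> poly_invariants n \<Longrightarrow> g \<in> poly_invariants n \<Longrightarrow> f + g \<in> poly_invariants n"
  "f \<in> poly_invariants n \<Longrightarrow> g \<in> poly_invariants n \<Longrightarrow> f * g \<in> poly_invariants n"
  by (simp_all add: poly_invariants_iff_generators poly_action_1 poly_action_0 poly_action_minus
      poly_action_add poly_action_mult)

lemma cring_poly_invariant_ring: "cring (poly_invariant_ring n)"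
proof (rule cringI)
  show "abelian_group (poly_invariant_ring n)"
    by (rule abelian_groupI)
      (auto simp: poly_invariant_ring_def poly_invariants_closed ac_simps
        intro: bexI[of _ "- x" for x])
  show "Group.comm_monoid (poly_invariant_ring n)"
    by (rule comm_monoidI) (auto simp: poly_invariant_ring_def poly_invariants_closed ac_simps)
qed (auto simp: poly_invariant_ring_def distrib_right)

lemma subspace_lie_invariants: "L.subspace (lie_invariants n)"
  by (auto simp: L.subspace_def lie_invariants_def lie_action.zero lie_action.add lie_action.scale)

lemma subspace_commutator_invariants: "L.subspace (commutator_ideal \<inter> lie_invariants n)"
  by (intro L.subspace_inter subspace_commutator_ideal subspace_lie_invariants)

lemma poly_act_invariant:
  assumes "f \<in> poly_invariants n" "w \<in> commutator_ideal" "w \<in> lie_invariants n"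
  shows "poly_act f w \<in> lie_invariants n"
  using assms by (auto simp: lie_invariants_def poly_invariants_def lie_action_poly_act dihedral_linear)

lemma module_commutator_invariants:
  "Module.module (poly_invariant_ring n) (commutator_invariant_module n)"
proof (rule moduleI)
  show "abelian_group (commutator_invariant_module n)"
  proof (rule abelian_groupI)
    fix w assume "w \<in> carrier (commutator_invariant_module n)"
    then show "\<exists>z\<in>carrier (commutator_invariant_module n).
        z \<oplus>\<^bsub>commutator_invariant_module n\<^esub> w = \<zero>\<^bsub>commutator_invariant_module n\<^esub>"
      using L.subspace_neg[OF subspace_commutator_invariants, of w n]
      by (intro bexI[of _ "- w"]) (simp_all add: commutator_invariant_module_def)
  qed (use L.subspace_add[OF subspace_commutator_invariants]
      L.subspace_0[OF subspace_commutator_invariants]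
      in \<open>auto simp: commutator_invariant_module_def ac_simps\<close>)
qed (auto simp: commutator_invariant_module_def poly_invariant_ring_def poly_act_add_left
    poly_act_add_right poly_act_mult poly_act_closed poly_act_invariant
    cring_poly_invariant_ring[unfolded poly_invariant_ring_def])

lemma (in Module.module) span_singleton:
  assumes "w \<in> carrier M"
  shows "span {w} = (\<lambda>a. a \<odot>\<^bsub>M\<^esub> w) ` carrier R"
proof -
  have "lincomb a {w} = a w \<odot>\<^bsub>M\<^esub> w" if "a w \<in> carrier R" for a
    using assms that by (simp add: lincomb_def)
  then have "(\<lambda>a. lincomb a {w}) ` ({w} \<rightarrow> carrier R) = (\<lambda>a. a w \<odot>\<^bsub>M\<^esub> w) ` ({w} \<rightarrow> carrier R)"
    by (intro image_cong) auto
  moreover have "span {w} = (\<lambda>a. lincomb a {w}) ` ({w} \<rightarrow> carrier R)"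
    using assms by (subst finite_span) auto
  ultimately have "span {w} = (\<lambda>a. a w \<odot>\<^bsub>M\<^esub> w) ` ({w} \<rightarrow> carrier R)"
    by simp
  also have "\<dots> = (\<lambda>a. a \<odot>\<^bsub>M\<^esub> w) ` (\<lambda>a. a w) ` ({w} \<rightarrow> carrier R)"
    by (simp only: image_image)
  also have "(\<lambda>a. a w) ` ({w} \<rightarrow> carrier R) = carrier R"
    by (auto intro!: image_eqI[of _ _ "\<lambda>_. r" for r])
  finally show ?thesis .
qed

lemma (in Module.module) lin_indpt_singleton:
  assumes "w \<in> carrier M" and "\<And>a. a \<in> carrier R \<Longrightarrow> a \<odot>\<^bsub>M\<^esub> w = \<zero>\<^bsub>M\<^esub> \<Longrightarrow> a = \<zero>\<^bsub>R\<^esub>"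
  shows "lin_indpt {w}"
  using assms by (intro finite_lin_indpt2) (auto simp: lincomb_def)

lemma ad_power_diff_eq_poly_act:
  "(ad genU ^^ n) vu - (ad genV ^^ n) vu = poly_act (polyU ^ n - polyV ^ n) vu"
  by (simp add: poly_act_diff_left polyU_power polyV_power poly_act_bimonom)

lemma freely_generated_commutator_invariants:
  assumes n: "n \<ge> 2"
  shows "freely_generated_by (poly_invariant_ring n) (commutator_invariant_module n)
    {(ad genU ^^ n) vu - (ad genV ^^ n) vu}"
proof -
  let ?d = "polyU ^ n - polyV ^ n"
  let ?w = "poly_act ?d vu"
  interpret M: Module.module "poly_invariant_ring n" "commutator_invariant_module n"
    by (rule module_commutator_invariants)
  have n0: "n > 0"
    using n by simp
  have carrier: "carrier (commutator_invariant_module n) = (\<lambda>f. poly_act f vu) ` skew_invariants n"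
    using lie_invariants_eq[OF n]
    by (auto simp: commutator_invariant_module_def poly_act_closed)
  have w: "?w \<in> carrier (commutator_invariant_module n)"
    unfolding carrier by (intro imageI power_diff_skew_invariant n0)
  have act: "g \<odot>\<^bsub>commutator_invariant_module n\<^esub> ?w = poly_act (g * ?d) vu" for g
    by (simp add: commutator_invariant_module_def poly_act_mult)
  have "M.span {?w} = carrier (commutator_invariant_module n)"
    unfolding M.span_singleton[OF w] act carrier skew_invariants_eq[OF n0] image_image
    by (simp add: poly_invariant_ring_def)
  moreover have "\<not> M.lin_dep {?w}"
    by (rule M.lin_indpt_singleton[OF w], unfold act)
      (use power_diff_nonzero[OF n0] poly_act_vu_eq_iff[of _ 0]
        in \<open>simp add: commutator_invariant_module_def poly_invariant_ring_def\<close>)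
  ultimately show ?thesis
    using w by (simp add: freely_generated_by_def ad_power_diff_eq_poly_act M.module_axioms)
qed

section \<open>The grading\<close>

lemma homogeneous_component_brk:
  assumes "a \<in> homogeneous_component i" "b \<in> homogeneous_component j"
  shows "brkL a b \<in> homogeneous_component (i + j)"
  using assms(1) unfolding homogeneous_component_def[of i]
proof (induction rule: L.span_induct_alt)
  case base
  show ?case
    by (simp add: homogeneous_component_def L.span_zero)
next
  case (step c m y)
  have "brkL m b \<in> homogeneous_component (i + j)"
    using assms(2) unfolding homogeneous_component_def[of j]
  proof (induction rule: L.span_induct_alt)
    case base
    show ?case
      by (simp add: homogeneous_component_def L.span_zero)
  next
    case (step d k z)
    with \<open>m \<in> {m. lie_monomial m i}\<close> have "lie_monomial (brkL m k) (i + j)"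
      by (auto intro: lie_monomial.intros)
    with step show ?case
      by (simp add: homogeneous_component_def L.brk_add_right L.brk_scale_right L.span_add
          L.span_scale L.span_base)
  qed
  with step show ?case
    by (simp add: homogeneous_component_def L.brk_add_left L.brk_scale_left L.span_add L.span_scale)
qed

lemma subspace_homogeneous_component: "L.subspace (homogeneous_component i)"
  unfolding homogeneous_component_def by (rule L.subspace_span)

lemma lin_lie_homogeneous: "lin_lie p \<in> homogeneous_component 1"
  unfolding lin_lie_genXY homogeneous_component_def
  by (intro L.span_add L.span_scale L.span_base) (simp_all add: lie_monomial.intros[simplified])

lemma ad_lin_lie_power_homogeneous:
  "w \<in> homogeneous_component i \<Longrightarrow> (ad (lin_lie p) ^^ k) w \<in> homogeneous_component (i + k)"
proof (induction k)
  case (Suc k)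
  then show ?case
    using homogeneous_component_brk[OF Suc.IH lin_lie_homogeneous] by (simp add: ad_def)
qed simp

text \<open>
  The dilation by 2 detects degrees: it acts on the component of degree \<open>k\<close> as \<open>2^k\<close>, and these
  numbers are distinct.
\<close>

lemma dilation_homogeneous:
  assumes "w \<in> homogeneous_component k"
  shows "lie_action (\<lambda>p. 2 *s p) w = scaleL (2 ^ k) w"
proof -
  let ?g = "\<lambda>p :: complex^2. 2 *s p"
  have g: "Vector_Spaces.linear (*s) (*s) ?g"
    by (rule linear_on_vec) (simp_all add: vec.scale_right_distrib mult.commute)
  have gen: "lie_action ?g (lin_lie p) = scaleL 2 (lin_lie p)" for p
    by (simp only: lie_action_lin_lie[OF g] lin_lie_scale)
  have mono: "lie_action ?g m = scaleL (2 ^ i) m" if "lie_monomial m i" for m i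
    using that
  proof induction
    case 1
    then show ?case
      by (simp only: genX_eq_lin_lie gen power_one_right)
  next
    case 2
    then show ?case
      by (simp only: genY_eq_lin_lie gen power_one_right)
  qed (simp add: lie_action_brk L.brk_scale_left L.brk_scale_right power_add mult.commute)
  show ?thesis
    using assms unfolding homogeneous_component_def
    by (induction rule: L.span_induct_alt)
      (simp_all add: mono lie_action.add lie_action.scale lie_action.zero L.scale_right_distrib
        mult.commute)
qed

text \<open>
  The degree is that of the polynomial plus 2, the degree of \<open>[v, u]\<close>. If the element is homogeneous,
  comparing coefficients of its image under the dilation by 2 shows that each monomial of \<open>f\<close> has
  the required degree.
\<close>

lemma poly_act_vu_homogeneous_iff:
  "poly_act f vu \<in> homogeneous_component k \<longleftrightarrow> (\<forall>i j. bicoeff f i j \<noteq> 0 \<longrightarrow> i + j + 2 = k)"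
proof (intro iffI allI impI)
  fix i j
  let ?g = "\<lambda>p :: complex^2. 2 *s p"
  assume w: "poly_act f vu \<in> homogeneous_component k" and ij: "bicoeff f i j \<noteq> 0"
  have g: "Vector_Spaces.linear (*s) (*s) ?g"
    by (rule linear_on_vec) (simp_all add: vec.scale_right_distrib mult.commute)
  \<comment> \<open>The dilation by 2 has determinant 4.\<close>
  have "lie_action ?g vu = scaleL 4 vu"
    by (simp add: lie_action_vu[OF g])
  then have "lie_action ?g (poly_act f vu) = poly_act ([:[:4:]:] * poly_action ?g f) vu"
    by (simp only: lie_action_poly_act[OF g] vu_in_commutator_ideal poly_act_scale_right
        poly_act_const_mult)
  also have "lie_action ?g (poly_act f vu) = poly_act ([:[:2 ^ k:]:] * f) vu"
    by (simp only: dilation_homogeneous[OF w] poly_act_const_mult)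
  finally have "[:[:2 ^ k:]:] * f = [:[:4:]:] * poly_action ?g f"
    by (simp only: poly_act_vu_eq_iff)
  then have "bicoeff ([:[:2 ^ k:]:] * f) i j = bicoeff ([:[:4:]:] * poly_action ?g f) i j"
    by (simp only:)
  moreover have "bicoeff (poly_action ?g f) i j = 2 ^ i * 2 ^ j * bicoeff f i j"
    by (rule bicoeff_poly_action_diagonal) (simp_all add: vec_eq_iff forall_2)
  ultimately have "2 ^ k * bicoeff f i j = 4 * (2 ^ i * 2 ^ j * bicoeff f i j)"
    by (simp only: bicoeff_const_mult)
  then have "(2::complex) ^ k = 2 ^ (i + j + 2)"
    using ij by (simp add: power_add)
  then have "of_nat (2 ^ k) = (of_nat (2 ^ (i + j + 2)) :: complex)"
    by (simp only: of_nat_power of_nat_numeral)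
  then have "(2::nat) ^ k = 2 ^ (i + j + 2)"
    by (simp only: of_nat_eq_iff)
  then show "i + j + 2 = k"
    by (simp only: power_inject_exp one_less_numeral_iff semiring_norm)
next
  assume hom: "\<forall>i j. bicoeff f i j \<noteq> 0 \<longrightarrow> i + j + 2 = k"
  have vu: "vu \<in> homogeneous_component 2"
    using homogeneous_component_brk[OF lin_lie_homogeneous lin_lie_homogeneous]
    by (simp add: genU_eq_lin_lie genV_eq_lin_lie numeral_2_eq_2)
  have "poly_act (bimonom (bicoeff f i j) i j) vu \<in> homogeneous_component k" for i j
  proof (cases "bicoeff f i j = 0")
    case True
    then show ?thesis
      by (simp add: L.subspace_0[OF subspace_homogeneous_component])
  next
    case False
    then have "k = 2 + i + j"
      using hom by force
    have "(ad genV ^^ j) ((ad genU ^^ i) vu) \<in> homogeneous_component (2 + i + j)"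
      using ad_lin_lie_power_homogeneous[OF ad_lin_lie_power_homogeneous[OF vu]]
      by (simp only: genU_eq_lin_lie genV_eq_lin_lie)
    then show ?thesis
      unfolding poly_act_bimonom \<open>k = 2 + i + j\<close>
      by (rule L.subspace_scale[OF subspace_homogeneous_component])
  qed
  then show "poly_act f vu \<in> homogeneous_component k"
    by (subst bipoly_as_sum)
      (auto simp: poly_act_sum_left intro!: L.subspace_sum[OF subspace_homogeneous_component])
qed

section \<open>The Hilbert series\<close>

lemma skew_invariants_iff:
  assumes "n > 0"
  shows "f \<in> skew_invariants n \<longleftrightarrow>
    (\<forall>i j. (bicoeff f i j \<noteq> 0 \<longrightarrow> i mod n = j mod n) \<and> bicoeff f j i = - bicoeff f i j)"
proof -
  have "poly_action reflection f = - f \<longleftrightarrow> (\<forall>i j. bicoeff f j i = - bicoeff f i j)"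
    by (metis bipoly_eqI bicoeff_reflection bicoeff_minus)
  then show ?thesis
    using assms by (auto simp: skew_invariants_def rotation_fixes_poly_iff)
qed

text \<open>
  The basis consists of the elements \<open>[v, u] e j\<close>, for \<open>j\<close> in the set on the right, with
  \<open>e j = u^(m - j) v^j - u^j v^(m - j)\<close>. As \<open>j < m - j\<close>, the monomial \<open>u^(m - j) v^j\<close> occurs in \<open>e j\<close>
  and in no other basis element. The coefficients of these monomials therefore prove independence
  and are the coordinates of an arbitrary skew-invariant of degree \<open>m\<close>.
\<close>

lemma dim_homogeneous_invariants:
  assumes n: "n \<ge> 2"
  shows "L.dim (lie_invariants n \<inter> homogeneous_component (m + 2)) = card {j. 2 * j < m \<and> n dvd m - 2 * j}"
proof -
  define J where "J = {j. 2 * j < m \<and> n dvd m - 2 * j}"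
  define e :: "nat \<Rightarrow> complex poly poly" where
    "e j = bimonom 1 (m - j) j - bimonom 1 j (m - j)" for j
  define b where "b j = poly_act (e j) vu" for j
  let ?V = "lie_invariants n \<inter> homogeneous_component (m + 2)"
  have n0: "n > 0"
    using n by simp
  have finJ: "finite J"
    by (rule finite_subset[of _ "{..<m}"]) (auto simp: J_def)
  have lead: "bicoeff (e j) (m - l) l = (if j = l then 1 else 0)" if "j \<in> J" "l \<in> J" for j l
    using that by (auto simp: e_def J_def bicoeff_bimonom)
  have e_skew: "bicoeff (e j) i l = - bicoeff (e j) l i" for i j l
    unfolding e_def bicoeff_diff bicoeff_bimonom by (simp only: conj_commute minus_diff_eq)
  have e_support: "(i = m - j \<and> l = j) \<or> (i = j \<and> l = m - j)" if "bicoeff (e j) i l \<noteq> 0" for i j l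
  proof (rule ccontr)
    assume "\<not> ((i = m - j \<and> l = j) \<or> (i = j \<and> l = m - j))"
    then have "\<not> (m - j = i \<and> j = l)" "\<not> (j = i \<and> m - j = l)"
      by blast+
    with that show False
      unfolding e_def bicoeff_diff bicoeff_bimonom by (simp only: if_False diff_self simp_thms)
  qed
  have "inj_on b J"
  proof (rule inj_onI)
    fix j l assume "j \<in> J" "l \<in> J" "b j = b l"
    then show "j = l"
      using lead[of j l] lead[of l l] by (auto simp: b_def poly_act_vu_eq_iff split: if_splits)
  qed
  have "L.independent (b ` J)"
  proof (rule L.independent_if_scalars_zero)
    fix c x assume "(\<Sum>x\<in>b ` J. scaleL (c x) x) = 0" and "x \<in> b ` J"
    then obtain l where l: "l \<in> J" "x = b l"
      by blast
    have "poly_act (\<Sum>j\<in>J. [:[:c (b j):]:] * e j) vu = (\<Sum>x\<in>b ` J. scaleL (c x) x)"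
      by (simp only: sum.reindex[OF \<open>inj_on b J\<close>] poly_act_sum_left poly_act_const_mult b_def o_def)
    also have "\<dots> = poly_act 0 vu"
      using \<open>(\<Sum>x\<in>b ` J. scaleL (c x) x) = 0\<close> by simp
    finally have "bicoeff (\<Sum>j\<in>J. [:[:c (b j):]:] * e j) (m - l) l = 0"
      by (simp only: poly_act_vu_eq_iff bicoeff_0)
    also have "bicoeff (\<Sum>j\<in>J. [:[:c (b j):]:] * e j) (m - l) l =
        (\<Sum>j\<in>J. if j = l then c (b j) else 0)"
      unfolding bicoeff_sum bicoeff_const_mult by (intro sum.cong) (simp_all add: lead l)
    finally show "c x = 0"
      using l finJ by simp
  qed (simp add: finJ)
  moreover have "L.span (b ` J) = L.span ?V"
    unfolding L.span_eq
  proof (intro conjI subsetI)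
    fix x assume "x \<in> b ` J"
    then obtain j where j: "j \<in> J" "x = b j"
      by blast
    then have "2 * j < m" "n dvd m - 2 * j"
      by (simp_all add: J_def)
    then have "j \<le> m - j" "n dvd m - j - j"
      by (simp_all add: mult_2)
    then have "(m - j) mod n = j mod n"
      by (simp add: mod_eq_dvd_iff_nat)
    then have "i mod n = l mod n" if "bicoeff (e j) i l \<noteq> 0" for i l
      using e_support[OF that] by metis
    then have "e j \<in> skew_invariants n"
      unfolding skew_invariants_iff[OF n0] using e_skew by blast
    moreover have "b j \<in> homogeneous_component (m + 2)"
      unfolding b_def poly_act_vu_homogeneous_iff using e_support[of j] \<open>j \<le> m - j\<close> by fastforce
    ultimately show "x \<in> L.span ?V"
      using j by (intro L.span_base) (simp add: b_def poly_act_vu_invariant_iff)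
  next
    fix x assume x: "x \<in> ?V"
    then obtain f where f: "f \<in> skew_invariants n" "x = poly_act f vu"
      using lie_invariants_eq[OF n] by blast
    have deg: "i + j = m" if "bicoeff f i j \<noteq> 0" for i j
      using x that by (auto simp: f poly_act_vu_homogeneous_iff)
    have cong: "i mod n = j mod n" if "bicoeff f i j \<noteq> 0" for i j
      using f(1)[unfolded skew_invariants_iff[OF n0]] that by blast
    have skew: "bicoeff f j i = - bicoeff f i j" for i j
      using f(1)[unfolded skew_invariants_iff[OF n0]] by blast
    have upper: "bicoeff (\<Sum>j\<in>J. [:[:bicoeff f (m - j) j:]:] * e j) i l = bicoeff f i l"
      if "l < i" "i + l = m" for i l
    proof -
      have "bicoeff (e j) i l = (if j = l then 1 else 0)" if "j \<in> J" for j
        using that \<open>l < i\<close> \<open>i + l = m\<close> by (auto simp: e_def J_def bicoeff_bimonom)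
      then have "bicoeff (\<Sum>j\<in>J. [:[:bicoeff f (m - j) j:]:] * e j) i l =
          (\<Sum>j\<in>J. if j = l then bicoeff f (m - j) j else 0)"
        unfolding bicoeff_sum bicoeff_const_mult by (intro sum.cong) simp_all
      also have "\<dots> = (if l \<in> J then bicoeff f i l else 0)"
        using finJ \<open>i + l = m\<close> by auto
      also have "\<dots> = bicoeff f i l"
      proof (cases "bicoeff f i l = 0")
        case False
        then have "n dvd i - l"
          using cong[of i l] \<open>l < i\<close> by (simp add: mod_eq_dvd_iff_nat)
        then show ?thesis
          using that by (simp add: J_def mult_2 flip: \<open>i + l = m\<close>)
      qed simp
      finally show ?thesis .
    qed
    have sum_skew: "bicoeff (\<Sum>j\<in>J. [:[:bicoeff f (m - j) j:]:] * e j) i l =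
        - bicoeff (\<Sum>j\<in>J. [:[:bicoeff f (m - j) j:]:] * e j) l i" for i l
      unfolding bicoeff_sum bicoeff_const_mult sum_negf[symmetric]
      by (intro sum.cong refl) (simp add: e_skew[of _ i l])
    have "f = (\<Sum>j\<in>J. [:[:bicoeff f (m - j) j:]:] * e j)"
    proof (rule bipoly_eqI)
      fix i l
      \<comment> \<open>The coefficients with \<open>l < i\<close> are known; those with \<open>i < l\<close> follow by skewness,
        and those with \<open>i = l\<close> vanish.\<close>
      consider "i + l \<noteq> m" | "i + l = m" "l < i" | "i + l = m" "i < l" | "i = l"
        by linarith
      then show "bicoeff f i l = bicoeff (\<Sum>j\<in>J. [:[:bicoeff f (m - j) j:]:] * e j) i l"
      proof cases
        case 1
        then have "bicoeff (e j) i l = 0" if "j \<in> J" for j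
          using that by (auto simp: e_def J_def bicoeff_bimonom)
        then show ?thesis
          unfolding bicoeff_sum bicoeff_const_mult using 1 deg[of i l] by auto
      next
        case 2
        then show ?thesis
          by (simp only: upper)
      next
        case 3
        then show ?thesis
          using upper[of i l] sum_skew[of i l] skew[of i l] by (simp only: add.commute)
      next
        case 4
        have zero: "z = - z \<Longrightarrow> z = 0" for z :: complex
          by simp
        from 4 have "bicoeff f i l = 0" "bicoeff (\<Sum>j\<in>J. [:[:bicoeff f (m - j) j:]:] * e j) i l = 0"
          using skew[of i i] sum_skew[of i i] by (intro zero; simp only:)+
        then show ?thesis
          by simp
      qed
    qed
    then have "x = (\<Sum>j\<in>J. scaleL (bicoeff f (m - j) j) (b j))"
      unfolding f b_def by (metis (no_types, lifting) poly_act_sum_left poly_act_const_mult sum.cong)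
    then show "x \<in> L.span (b ` J)"
      by (auto intro!: L.span_sum L.span_scale intro: L.span_base)
  qed
  ultimately have "L.dim ?V = card (b ` J)"
    by (intro L.dim_eq_card)
  then show ?thesis
    using card_image[OF \<open>inj_on b J\<close>] by (simp add: J_def)
qed

text \<open>
  An invariant lies in the commutator ideal, which starts in degree 2.
\<close>

lemma low_degree_invariants:
  assumes "n \<ge> 2" "k < 2"
  shows "lie_invariants n \<inter> homogeneous_component k = {0}"
proof -
  have "w = 0" if w: "w \<in> lie_invariants n" "w \<in> homogeneous_component k" for w
  proof -
    obtain f where f: "w = poly_act f vu"
      using w lie_invariants_eq[OF assms(1)] by blast
    have "bicoeff f i j = 0" for i j
      using w(2) assms(2) unfolding f poly_act_vu_homogeneous_iff by force
    then have "f = 0"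
      by (intro bipoly_eqI) simp
    then show ?thesis
      by (simp add: f)
  qed
  then show ?thesis
    using L.subspace_0[OF subspace_lie_invariants] L.subspace_0[OF subspace_homogeneous_component]
    by blast
qed

definition geometric_fps :: "nat \<Rightarrow> rat fps" where
  "geometric_fps k = Abs_fps (\<lambda>i. if k dvd i then 1 else 0)"

lemma geometric_fps_mult:
  assumes "k > 0"
  shows "geometric_fps k * (1 - fps_X ^ k) = 1"
proof (rule fps_ext)
  fix i
  show "(geometric_fps k * (1 - fps_X ^ k)) $ i = 1 $ i"
    using assms
    by (auto simp: geometric_fps_def right_diff_distrib fps_X_power_mult_right_nth dvd_minus_self dest: dvd_imp_le)
qed

lemma geometric_fps_product_nth:
  "(geometric_fps k * geometric_fps l) $ d = of_nat (card {i. i \<le> d \<and> k dvd i \<and> l dvd d - i})"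
proof -
  have "(geometric_fps k * geometric_fps l) $ d =
      (\<Sum>i\<in>{0..d}. if k dvd i \<and> l dvd d - i then 1 else 0)"
    unfolding fps_mult_nth geometric_fps_def by (intro sum.cong) auto
  also have "\<dots> = (\<Sum>i\<in>{i\<in>{0..d}. k dvd i \<and> l dvd d - i}. 1)"
    by (rule sum.inter_filter[symmetric]) simp
  also have "\<dots> = of_nat (card {i. i \<le> d \<and> k dvd i \<and> l dvd d - i})"
    by simp
  finally show ?thesis .
qed

lemma hilbert_series_lie_invariants:
  assumes n: "n \<ge> 2"
  shows "hilbert_series (lie_invariants n) = fps_X ^ (n + 2) / ((1 - fps_X ^ 2) * (1 - fps_X ^ n))"
proof -
  let ?G = "geometric_fps 2 * geometric_fps n"
  let ?D = "(1 - fps_X ^ 2) * (1 - fps_X ^ n) :: rat fps"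
  have factors: "geometric_fps 2 * (1 - fps_X ^ 2) = 1" "geometric_fps n * (1 - fps_X ^ n) = 1"
    using n by (auto intro!: geometric_fps_mult)
  have "?G * ?D = (geometric_fps 2 * (1 - fps_X ^ 2)) * (geometric_fps n * (1 - fps_X ^ n))"
    by (simp only: mult_ac)
  then have inverse: "?G * ?D = 1"
    by (simp only: factors mult_1_right)
  have "?D \<noteq> 0"
  proof
    assume "?D = 0"
    then show False
      using inverse by (simp only: mult_zero_right zero_neq_one)
  qed
  have "hilbert_series (lie_invariants n) = fps_X ^ (n + 2) * ?G"
  proof (rule fps_ext)
    fix k
    have nth: "(fps_X ^ (n + 2) * ?G) $ k = (if k < n + 2 then 0 else ?G $ (k - (n + 2)))"
      by (rule fps_X_power_mult_nth)
    \<comment> \<open>Degrees 0 and 1 have no invariants; degrees from 2 to \<open>n + 1\<close> have none as \<open>n\<close>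
      would divide a smaller positive number.\<close>
    consider "k < 2" | m where "k = m + 2" "m < n" | d where "k = d + n + 2"
      by (metis add.commute le_Suc_ex not_less)
    then show "hilbert_series (lie_invariants n) $ k = (fps_X ^ (n + 2) * ?G) $ k"
    proof cases
      case 1
      have "L.dim {0} = 0"
        using L.dim_eq_card[of "{}" "{0}"] by (simp add: L.independent_empty)
      then show ?thesis
        unfolding nth using 1 n by (simp add: hilbert_series_def low_degree_invariants)
    next
      case 2
      then have "{j. 2 * j < m \<and> n dvd m - 2 * j} = {}"
        by (auto dest: dvd_imp_le)
      then have "L.dim (lie_invariants n \<inter> homogeneous_component k) = 0"
        by (simp only: 2 dim_homogeneous_invariants[OF n] card.empty)
      then show ?thesis
        unfolding nth using 2 by (simp add: hilbert_series_def)
    next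
      case 3
      \<comment> \<open>The exponent \<open>j\<close> of a basis element corresponds to the part \<open>2 j\<close> of a decomposition of \<open>d\<close>.\<close>
      have "{i. i \<le> d \<and> 2 dvd i \<and> n dvd d - i} = (\<lambda>j. 2 * j) ` {j. 2 * j < d + n \<and> n dvd d + n - 2 * j}"
        (is "?A = _ ` ?B")
      proof (intro equalityI subsetI)
        fix i assume i: "i \<in> ?A"
        then obtain j where "i = 2 * j"
          by blast
        then have d: "d + n - 2 * j = (d - i) + n"
          using i by simp
        have "n dvd d + n - 2 * j"
          unfolding d using i by (intro dvd_add) simp_all
        moreover have "2 * j < d + n"
          using i n \<open>i = 2 * j\<close> by simp
        ultimately have "j \<in> ?B"
          by simp
        with \<open>i = 2 * j\<close> show "i \<in> (\<lambda>j. 2 * j) ` ?B"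
          by (rule image_eqI)
      next
        fix i assume "i \<in> (\<lambda>j. 2 * j) ` ?B"
        then obtain j where j: "i = 2 * j" "2 * j < d + n" "n dvd d + n - 2 * j"
          by blast
        then have "n \<le> d + n - 2 * j"
          by (intro dvd_imp_le) simp_all
        then have d: "d + n - 2 * j = (d - i) + n" and "i \<le> d"
          using j by simp_all
        have "n dvd d - i"
          using j(3) unfolding d by (simp only: dvd_add_left_iff[OF dvd_refl])
        then show "i \<in> ?A"
          using j \<open>i \<le> d\<close> by simp
      qed
      then have "card ?A = card ?B"
        by (simp add: card_image inj_on_def)
      then show ?thesis
        unfolding nth
        using 3 dim_homogeneous_invariants[OF n, of "d + n"] geometric_fps_product_nth[of 2 n d]
        by (simp add: hilbert_series_def)
    qed
  qed
  also have "\<dots> = fps_X ^ (n + 2) * ?G * ?D / ?D"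
    using \<open>?D \<noteq> 0\<close> by (rule nonzero_mult_div_cancel_right[symmetric])
  also have "fps_X ^ (n + 2) * ?G * ?D = fps_X ^ (n + 2)"
    by (simp only: mult.assoc[of _ ?G ?D] inverse mult_1_right)
  finally show ?thesis .
qed

theorem theorem3p7:
  fixes n :: nat
  assumes "n \<ge> 3"
  shows "freely_generated_by (poly_invariant_ring n) (commutator_invariant_module n)
           {(ad genU ^^ n) (brkL genV genU) - (ad genV ^^ n) (brkL genV genU)} \<and>
         hilbert_series (lie_invariants n) =
           fps_X ^ (n + 2) / ((1 - fps_X ^ 2) * (1 - fps_X ^ n))"
  using assms by (simp add: freely_generated_commutator_invariants hilbert_series_lie_invariants)

end
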